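(* Let $\lambda\in P^+$ and $J=\{i\in I\mid\langle\alpha_i^\vee,\lambda\rangle=0\}$. For every semi-infinite LS path $\eta=(x_1,\dots,x_s;a_0,\dots,a_s)\in\mathbb B^{\frac\infty2}(\lambda)$ of shape $\lambda$, the pair $$\overline\eta:=(x_1\lambda,\dots,x_s\lambda;\,a_0,\dots,a_s)$$ is a Lakshmibai-Seshadri path of shape $\lambda$, i.e. $\overline\eta\in\mathbb B(\lambda)$. Thus one obtains a map $\mathbb B^{\frac\infty2}(\lambda)\to\mathbb B(\lambda)$, $\eta\mapsto\overline\eta$.
   Context: **Affine data.** $\mathfrak g_{\mathrm{af}}$ is an untwisted affine Lie algebra over $\mathbb C$ with simple roots $\{\alpha_i\}_{i\in I_{\mathrm{af}}}$, simple coroots $\{\alpha_i^\vee\}$, pairing $\langle\cdot,\cdot\rangle$, null root $\delta=\sum a_i\alpha_i$, canonical central element $c=\sum a_i^\vee\alpha_i^\vee$. Fix $0\in I_{\mathrm{af}}$ with $a_0=a_0^\vee=1$; $I=I_{\mathrm{af}}\setminus\{0\}$. $P_{\mathrm{af}}$ is an integral weight lattice containing all $\alpha_i$ and fundamental weights $\Lambda_i$. $\varpi_i=\Lambda_i-\langle c,\Lambda_i\rangle\Lambda_0$ for $i\in I$; $P^+=\sum_{i\in I}\mathbb Z_{\ge0}\varpi_i$; $Q^\vee=\bigoplus_{i\in I}\mathbb Z\alpha_i^\vee$. $W_{\mathrm{af}}=\langle r_i\mid i\in I_{\mathrm{af}}\rangle=W\ltimes\{t_\xi\mid\xi\in Q^\vee\}$,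 $W=\langle r_i\mid i\in I\rangle$, $t_\xi$ the translation by $\xi$; $wt_\xi\mu=w\mu-\langle\xi,\mu\rangle\delta$ if $\langle c,\mu\rangle=0$. $\Delta$ is the finite root system for $I$, $\Delta^+$ its positive roots; real roots $\Delta_{\mathrm{af}}=\{\alpha+n\delta\mid\alpha\in\Delta,n\in\mathbb Z\}$, $\Delta_{\mathrm{af}}^+=\Delta^+\sqcup\{\alpha+n\delta\mid\alpha\in\Delta,n>0\}$; $r_\beta$, $\beta^\vee$ are the reflection and coroot of $\beta$. **SiLS paths.** For $J\subset I$: $\Delta_J=\Delta\cap\bigoplus_{j\in J}\mathbb Z\alpha_j$, $(\Delta_J)_{\mathrm{af}}^+=\{\alpha+n\delta\mid \alpha\in\Delta_J,n\in\mathbb Z\}\cap\Delta_{\mathrm{af}}^+$, $(W^J)_{\mathrm{af}}=\{x\in W_{\mathrm{af}}\mid x\beta\in\Delta_{\mathrm{af}}^+\ \forall\beta\in(\Delta_J)_{\mathrm{af}}^+\}$. For $x=vt_\zeta$ ($v\in W,\zeta\in Q^\vee$), $\ell^{\frac\infty2}(x)=\ell(v)+2\langle\zeta,\rho\rangle$, $\rho=\frac12\sum_{\alpha\in\Delta^+}\alpha$. The graph $\mathrm{SiB}^J$ has vertex set $(W^J)_{\mathrm{af}}$ and edges $x\xrightarrow{\beta}r_\beta x$ for $x\in(W^J)_{\mathrm{af}},\beta\in\Delta_{\mathrm{af}}^+$ with $r_\beta x\in(W^J)_{\mathrm{af}}$ and $\ell^{\frac\infty2}(r_\beta x)=\ell^{\frac\infty2}(x)+1$;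 $x\le_{\frac\infty2}y$ means there is a directed path from $x$ to $y$ in $\mathrm{SiB}^J$. For $\lambda\in P^+$, $J=\{i\in I\mid\langle\alpha_i^\vee,\lambda\rangle=0\}$ and rational $0<a\le1$, $\mathrm{SiB}(\lambda;a)$ is the subgraph of $\mathrm{SiB}^J$ with the same vertices and only the edges $x\xrightarrow{\beta}y$ with $a\langle\beta^\vee,x\lambda\rangle\in\mathbb Z$. $\mathbb B^{\frac\infty2}(\lambda)$ is the set of SiLS paths of shape $\lambda$: pairs $(x_1,\dots,x_s;a_0,\dots,a_s)$ with $x_1>_{\frac\infty2}\cdots>_{\frac\infty2}x_s$ in $(W^J)_{\mathrm{af}}$ and rationals $0=a_0<\cdots<a_s=1$ such that for each $1\le u\le s-1$ there is a directed path from $x_{u+1}$ to $x_u$ in $\mathrm{SiB}(\lambda;a_u)$. **LS paths.** On $W_{\mathrm{af}}\lambda$, $\mu\le\nu$ means there are $\mu=\nu_0,\nu_1,\dots,\nu_k=\nu$ in $W_{\mathrm{af}}\lambda$ and $\beta_1,\dots,\beta_k\in\Delta_{\mathrm{af}}^+$ with $\nu_m=r_{\beta_m}\nu_{m-1}$ and $\langle\beta_m^\vee,\nu_{m-1}\rangle\in\mathbb Z_{>0}$ for all $m$. $\mathrm{LZ}(\lambda)$ is the directed graph on $W_{\mathrm{af}}\lambda$ with an edge $\mu\xrightarrow{\beta}\nu$ whenever $\nu$ covers $\mu$ in this poset, $\beta\in\Delta_{\mathrm{af}}^+$ being the unique positive real root with $\nu=r_\beta\mu$ (and $\langle\beta^\vee,\mu\rangle>0$).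 For rational $0<a\le1$, $\mathrm{LZ}(\lambda;a)$ is the subgraph with the same vertices and only the edges $\mu\xrightarrow{\beta}\nu$ with $a\langle\beta^\vee,\mu\rangle\in\mathbb Z$. An LS path of shape $\lambda$ is a pair $(\nu_1,\dots,\nu_s;a_0,\dots,a_s)$ with $\nu_1>\cdots>\nu_s$ in $W_{\mathrm{af}}\lambda$ and rationals $0=a_0<a_1<\cdots<a_s=1$ such that for each $1\le u\le s-1$ there is a directed path from $\nu_{u+1}$ to $\nu_u$ in $\mathrm{LZ}(\lambda;a_u)$. $\mathbb B(\lambda)$ is the set of LS paths of shape $\lambda$. *)

theory Defs
  imports Complex_Main "HOL-Library.FuncSet"
begin

section \<open>Abelian groups as modules over the integers\<close>

definition int_scale :: "int \<Rightarrow> 'p::ab_group_add \<Rightarrow> 'p"  (infixr \<open>\<cdot>\<close> 75)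
  where "k \<cdot> x = (\<Sum>_<nat k. x) - (\<Sum>_<nat (- k). x)"

lemma int_scale_of_nat: "int n \<cdot> x = (\<Sum>_<n. x)"
  by (simp add: int_scale_def)

lemma int_scale_minus: "(- k) \<cdot> x = - (k \<cdot> x)"
  by (simp add: int_scale_def)

lemma sum_const_add:
  fixes x :: "'p::ab_group_add"
  shows "(\<Sum>_<m + n. x) = (\<Sum>_<m. x) + (\<Sum>_<n::nat. x)"
  by (induction n) (simp_all add: algebra_simps)

lemma int_scale_add_of_nat: "(int m + int n) \<cdot> x = int m \<cdot> x + int n \<cdot> x"
  by (simp only: of_nat_add [symmetric] int_scale_of_nat sum_const_add)

lemma int_scale_diff_of_nat: "(int m - int n) \<cdot> x = int m \<cdot> x - int n \<cdot> x"
proof (cases "n \<le> m")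
  case True
  then obtain d where "m = n + d" using le_Suc_ex by blast
  then show ?thesis by (simp add: int_scale_add_of_nat)
next
  case False
  then obtain d where d: "n = m + d" using le_Suc_ex nat_le_linear by blast
  then have "(int m - int n) \<cdot> x = - (int d \<cdot> x)"
    by (simp add: int_scale_minus)
  then show ?thesis by (simp add: d int_scale_add_of_nat)
qed

lemma int_scale_add_left: "(k + l) \<cdot> x = k \<cdot> x + l \<cdot> x"
proof -
  obtain a b c d where "k = int a - int b" "l = int c - int d"
    by (metis int_diff_cases)
  moreover have "(int a - int b) + (int c - int d) = int (a + c) - int (b + d)"
    by simp
  ultimately show ?thesis
    by (simp only: int_scale_diff_of_nat) (simp add: int_scale_add_of_nat)
qed

lemma int_scale_add_right: "k \<cdot> (x + y) = k \<cdot> x + k \<cdot> y"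
  by (simp add: int_scale_def sum.distrib algebra_simps)

lemma int_scale_one: "1 \<cdot> x = x"
  by (simp add: int_scale_def)

lemma int_scale_mult: "k \<cdot> (l \<cdot> x) = (k * l) \<cdot> x"
proof -
  have *: "int n \<cdot> (l \<cdot> x) = (int n * l) \<cdot> x" for n
    by (induction n)
       (simp_all add: int_scale_def [of 0] int_scale_add_left int_scale_one algebra_simps)
  show ?thesis
    by (cases k rule: int_cases2) (simp_all add: * int_scale_minus)
qed

interpretation int_module: module "int_scale :: int \<Rightarrow> 'p::ab_group_add \<Rightarrow> 'p"
  by unfold_locales
     (simp_all add: int_scale_add_left int_scale_add_right int_scale_mult int_scale_one)


section \<open>Affine data\<close>

text \<open>
  The type \<open>'i\<close> is the index set \<open>I\<^sub>a\<^sub>f\<close> of the affine Dynkin diagram and the type \<open>'p\<close> is the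
  integral weight lattice \<open>P\<^sub>a\<^sub>f\<close>. Elements of the dual lattice, in particular the coroots, are
  represented by integer-valued functions on \<open>P\<^sub>a\<^sub>f\<close>, so the pairing is function application.
\<close>

record ('i, 'p) affine_datum =
  node0 :: 'i
  sroot :: "'i \<Rightarrow> 'p"
  scoroot :: "'i \<Rightarrow> 'p \<Rightarrow> int"
  fweight :: "'i \<Rightarrow> 'p"
  mark :: "'i \<Rightarrow> int"
  comark :: "'i \<Rightarrow> int"

type_synonym ('i, 'p) affine = "('i, 'p) affine_datum"

definition fin_nodes :: "('i, 'p) affine \<Rightarrow> 'i set"
  where "fin_nodes D = UNIV - {node0 D}"

definition cartan :: "('i, 'p) affine \<Rightarrow> 'i \<Rightarrow> 'i \<Rightarrow> int"
  where "cartan D i j = scoroot D i (sroot D j)"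

definition null_root :: "('i::finite, 'p::ab_group_add) affine \<Rightarrow> 'p"
  where "null_root D = (\<Sum>i\<in>UNIV. mark D i \<cdot> sroot D i)"

definition central :: "('i::finite, 'p) affine \<Rightarrow> 'p \<Rightarrow> int"
  where "central D \<mu> = (\<Sum>i\<in>UNIV. comark D i * scoroot D i \<mu>)"

definition srefl :: "('i, 'p::ab_group_add) affine \<Rightarrow> 'i \<Rightarrow> 'p \<Rightarrow> 'p"
  where "srefl D i \<mu> = \<mu> - scoroot D i \<mu> \<cdot> sroot D i"

definition refl_word :: "('i, 'p::ab_group_add) affine \<Rightarrow> 'i list \<Rightarrow> 'p \<Rightarrow> 'p"
  where "refl_word D is = foldr (\<lambda>i w. srefl D i \<circ> w) is id"

text \<open>The group generated by the \<open>r\<^sub>i\<close>, \<open>i \<in> K\<close>; words suffice, since the \<open>r\<^sub>i\<close> are involutions.\<close>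

definition weyl_gen :: "('i, 'p::ab_group_add) affine \<Rightarrow> 'i set \<Rightarrow> ('p \<Rightarrow> 'p) set"
  where "weyl_gen D K = refl_word D ` lists K"

definition W_af :: "('i, 'p::ab_group_add) affine \<Rightarrow> ('p \<Rightarrow> 'p) set"
  where "W_af D = weyl_gen D UNIV"

definition W_fin :: "('i, 'p::ab_group_add) affine \<Rightarrow> ('p \<Rightarrow> 'p) set"
  where "W_fin D = weyl_gen D (fin_nodes D)"

definition weyl_length :: "('i, 'p::ab_group_add) affine \<Rightarrow> ('p \<Rightarrow> 'p) \<Rightarrow> nat"
  where "weyl_length D v =
    (LEAST n. \<exists>is\<in>lists (fin_nodes D). length is = n \<and> refl_word D is = v)"

definition root_span :: "('i, 'p::ab_group_add) affine \<Rightarrow> 'i set \<Rightarrow> 'p set"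
  where "root_span D K = {\<Sum>i\<in>K. k i \<cdot> sroot D i | k. True}"

definition root_cone :: "('i, 'p::ab_group_add) affine \<Rightarrow> 'i set \<Rightarrow> 'p set"
  where "root_cone D K = {\<Sum>i\<in>K. int (k i) \<cdot> sroot D i | k. True}"

definition fin_roots :: "('i, 'p::ab_group_add) affine \<Rightarrow> 'p set"
  where "fin_roots D = {w (sroot D i) | w i. w \<in> W_fin D \<and> i \<in> fin_nodes D}"

definition pos_fin_roots :: "('i, 'p::ab_group_add) affine \<Rightarrow> 'p set"
  where "pos_fin_roots D = fin_roots D \<inter> root_cone D (fin_nodes D)"

definition real_roots :: "('i::finite, 'p::ab_group_add) affine \<Rightarrow> 'p set"
  where "real_roots D = {\<alpha> + n \<cdot> null_root D | \<alpha> n. \<alpha> \<in> fin_roots D}"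

definition pos_real_roots :: "('i::finite, 'p::ab_group_add) affine \<Rightarrow> 'p set"
  where "pos_real_roots D =
    pos_fin_roots D \<union> {\<alpha> + n \<cdot> null_root D | \<alpha> n. \<alpha> \<in> fin_roots D \<and> 0 < n}"

definition weight_lattice :: "('i::finite, 'p::ab_group_add) affine \<Rightarrow> bool"
  where "weight_lattice D \<longleftrightarrow>
    (\<exists>B :: 'p set. finite B \<and> card B = card (UNIV :: 'i set) + 1 \<and>
       int_module.independent B \<and> int_module.span B = UNIV) \<and>
    (\<forall>i. additive (scoroot D i)) \<and>
    inj (sroot D) \<and> int_module.independent (range (sroot D)) \<and>
    (\<forall>i j. scoroot D i (fweight D j) = (if i = j then 1 else 0))"

text \<open>
  An indecomposable generalized Cartan matrix with positive left and right null vectors is of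
  affine type; the null vectors are the labels \<open>a\<^sub>i\<^sup>\<or>\<close> and \<open>a\<^sub>i\<close>, normalized by
  \<open>a\<^sub>0 = a\<^sub>0\<^sup>\<or> = 1\<close>.
\<close>

definition affine_cartan :: "('i::finite, 'p::ab_group_add) affine \<Rightarrow> bool"
  where "affine_cartan D \<longleftrightarrow>
    (\<forall>i. cartan D i i = 2) \<and>
    (\<forall>i j. i \<noteq> j \<longrightarrow> cartan D i j \<le> 0) \<and>
    (\<forall>i j. cartan D i j = 0 \<longrightarrow> cartan D j i = 0) \<and>
    (\<forall>K. K \<noteq> {} \<and> K \<noteq> UNIV \<longrightarrow> (\<exists>i\<in>K. \<exists>j\<in>-K. cartan D i j \<noteq> 0)) \<and>
    (\<forall>i. 0 < mark D i \<and> 0 < comark D i) \<and>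
    (\<forall>i. (\<Sum>j\<in>UNIV. cartan D i j * mark D j) = 0) \<and>
    (\<forall>j. (\<Sum>i\<in>UNIV. comark D i * cartan D i j) = 0) \<and>
    mark D (node0 D) = 1 \<and> comark D (node0 D) = 1"

text \<open>
  Untwisted: \<open>\<delta> - \<alpha>\<^sub>0\<close> is the highest root of the finite root system. In the twisted types with
  \<open>a\<^sub>0 = a\<^sub>0\<^sup>\<or> = 1\<close> it is the highest short root.
\<close>

definition untwisted_affine :: "('i::finite, 'p::ab_group_add) affine \<Rightarrow> bool"
  where "untwisted_affine D \<longleftrightarrow> weight_lattice D \<and> affine_cartan D \<and>
    null_root D - sroot D (node0 D) \<in> fin_roots D \<and>
    (\<forall>\<alpha>\<in>fin_roots D. null_root D - sroot D (node0 D) - \<alpha> \<in> root_cone D (fin_nodes D))"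

text \<open>The coroot \<open>w \<alpha>\<^sub>i\<^sup>\<or>\<close> of the real root \<open>w \<alpha>\<^sub>i\<close>, with \<open>W\<^sub>a\<^sub>f\<close> acting contragrediently.\<close>

definition coroot :: "('i, 'p::ab_group_add) affine \<Rightarrow> 'p \<Rightarrow> 'p \<Rightarrow> int"
  where "coroot D \<beta> =
    (THE h. \<exists>w\<in>W_af D. \<exists>i. \<beta> = w (sroot D i) \<and> (\<forall>\<mu>. h (w \<mu>) = scoroot D i \<mu>))"

definition refl :: "('i, 'p::ab_group_add) affine \<Rightarrow> 'p \<Rightarrow> 'p \<Rightarrow> 'p"
  where "refl D \<beta> \<mu> = \<mu> - coroot D \<beta> \<mu> \<cdot> \<beta>"

definition level_zero_weight :: "('i::finite, 'p::ab_group_add) affine \<Rightarrow> 'i \<Rightarrow> 'p"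
  where "level_zero_weight D i =
    fweight D i - central D (fweight D i) \<cdot> fweight D (node0 D)"

definition P_plus :: "('i::finite, 'p::ab_group_add) affine \<Rightarrow> 'p set"
  where "P_plus D = {\<Sum>i\<in>fin_nodes D. int (m i) \<cdot> level_zero_weight D i | m. True}"

definition Q_check :: "('i, 'p) affine \<Rightarrow> ('p \<Rightarrow> int) set"
  where "Q_check D = {(\<lambda>\<mu>. \<Sum>i\<in>fin_nodes D. k i * scoroot D i \<mu>) | k. True}"

text \<open>
  \<open>nu D \<xi>\<close> is the image of \<open>\<xi> \<in> Q\<^sup>\<or>\<close> in \<open>P\<^sub>a\<^sub>f\<close> under the normalized invariant form, which sends
  \<open>\<alpha>\<^sub>i\<^sup>\<or>\<close> to \<open>(a\<^sub>i / a\<^sub>i\<^sup>\<or>) \<alpha>\<^sub>i\<close>; the coefficient of \<open>\<alpha>\<^sub>i\<^sup>\<or>\<close> in \<open>\<xi>\<close> is \<open>\<xi> \<Lambda>\<^sub>i\<close>. Both integer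
  divisions below are exact in untwisted types, as \<open>a\<^sub>i\<^sup>\<or>\<close> divides \<open>a\<^sub>i\<close> and the form is even on \<open>Q\<^sup>\<or>\<close>.
  The translation is given by the usual formula
  \<open>t\<^sub>\<xi> \<mu> = \<mu> + \<langle>c, \<mu>\<rangle> \<nu>(\<xi>) - (\<langle>\<xi>, \<mu>\<rangle> + (\<xi>, \<xi>) \<langle>c, \<mu>\<rangle> / 2) \<delta>\<close>.
\<close>

definition nu :: "('i, 'p::ab_group_add) affine \<Rightarrow> ('p \<Rightarrow> int) \<Rightarrow> 'p"
  where "nu D \<xi> =
    (\<Sum>i\<in>fin_nodes D. (\<xi> (fweight D i) * (mark D i div comark D i)) \<cdot> sroot D i)"

definition transl :: "('i::finite, 'p::ab_group_add) affine \<Rightarrow> ('p \<Rightarrow> int) \<Rightarrow> 'p \<Rightarrow> 'p"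
  where "transl D \<xi> \<mu> =
    \<mu> + central D \<mu> \<cdot> nu D \<xi> - (\<xi> \<mu> + (\<xi> (nu D \<xi>) div 2) * central D \<mu>) \<cdot> null_root D"


section \<open>Semi-infinite Lakshmibai-Seshadri paths\<close>

definition J_roots :: "('i, 'p::ab_group_add) affine \<Rightarrow> 'i set \<Rightarrow> 'p set"
  where "J_roots D J = fin_roots D \<inter> root_span D J"

definition J_pos_real_roots :: "('i::finite, 'p::ab_group_add) affine \<Rightarrow> 'i set \<Rightarrow> 'p set"
  where "J_pos_real_roots D J =
    {\<alpha> + n \<cdot> null_root D | \<alpha> n. \<alpha> \<in> J_roots D J} \<inter> pos_real_roots D"

definition WJ_af :: "('i::finite, 'p::ab_group_add) affine \<Rightarrow> 'i set \<Rightarrow> ('p \<Rightarrow> 'p) set"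
  where "WJ_af D J =
    {x \<in> W_af D. \<forall>\<beta>\<in>J_pos_real_roots D J. x \<beta> \<in> pos_real_roots D}"

text \<open>The term \<open>2\<langle>\<zeta>, \<rho>\<rangle>\<close> is \<open>\<zeta>\<close> applied to \<open>2\<rho>\<close>, since \<open>\<rho>\<close> itself need not lie in \<open>P\<^sub>a\<^sub>f\<close>.\<close>

definition si_length :: "('i::finite, 'p::ab_group_add) affine \<Rightarrow> ('p \<Rightarrow> 'p) \<Rightarrow> int"
  where "si_length D x =
    (THE n. \<exists>v\<in>W_fin D. \<exists>\<zeta>\<in>Q_check D. x = v \<circ> transl D \<zeta> \<and>
       n = int (weyl_length D v) + \<zeta> (\<Sum>\<alpha>\<in>pos_fin_roots D. \<alpha>))"

definition sib_edge ::
    "('i::finite, 'p::ab_group_add) affine \<Rightarrow> 'i set \<Rightarrow> ('p \<Rightarrow> 'p) \<Rightarrow> 'p \<Rightarrow> ('p \<Rightarrow> 'p) \<Rightarrow> bool"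
  where "sib_edge D J x \<beta> y \<longleftrightarrow>
    x \<in> WJ_af D J \<and> \<beta> \<in> pos_real_roots D \<and> y = refl D \<beta> \<circ> x \<and> y \<in> WJ_af D J \<and>
    si_length D y = si_length D x + 1"

definition si_le ::
    "('i::finite, 'p::ab_group_add) affine \<Rightarrow> 'i set \<Rightarrow> ('p \<Rightarrow> 'p) \<Rightarrow> ('p \<Rightarrow> 'p) \<Rightarrow> bool"
  where "si_le D J = (\<lambda>x y. \<exists>\<beta>. sib_edge D J x \<beta> y)\<^sup>*\<^sup>*"

definition si_less ::
    "('i::finite, 'p::ab_group_add) affine \<Rightarrow> 'i set \<Rightarrow> ('p \<Rightarrow> 'p) \<Rightarrow> ('p \<Rightarrow> 'p) \<Rightarrow> bool"
  where "si_less D J x y \<longleftrightarrow> si_le D J x y \<and> x \<noteq> y"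

definition stab_nodes :: "('i, 'p) affine \<Rightarrow> 'p \<Rightarrow> 'i set"
  where "stab_nodes D lam = {i \<in> fin_nodes D. scoroot D i lam = 0}"

text \<open>Existence of a directed path in \<open>SiB(\<lambda>; a)\<close>.\<close>

definition sib_path ::
    "('i::finite, 'p::ab_group_add) affine \<Rightarrow> 'p \<Rightarrow> rat \<Rightarrow> ('p \<Rightarrow> 'p) \<Rightarrow> ('p \<Rightarrow> 'p) \<Rightarrow> bool"
  where "sib_path D lam a =
    (\<lambda>x y. \<exists>\<beta>. sib_edge D (stab_nodes D lam) x \<beta> y \<and>
       a * of_int (coroot D \<beta> (x lam)) \<in> \<int>)\<^sup>*\<^sup>*"

text \<open>
  A pair \<open>(x\<^sub>1, \<dots>, x\<^sub>s; a\<^sub>0, \<dots>, a\<^sub>s)\<close> is a pair of lists, so \<open>x\<^sub>u\<close> is \<open>xs ! (u - 1)\<close> and \<open>a\<^sub>u\<close> is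
  \<open>as ! u\<close>.
\<close>

definition rat_chain :: "nat \<Rightarrow> rat list \<Rightarrow> bool"
  where "rat_chain s as \<longleftrightarrow>
    length as = s + 1 \<and> as ! 0 = 0 \<and> as ! s = 1 \<and> sorted_wrt (<) as"

definition SiLS ::
    "('i::finite, 'p::ab_group_add) affine \<Rightarrow> 'p \<Rightarrow> (('p \<Rightarrow> 'p) list \<times> rat list) set"
  where "SiLS D lam = {(xs, as).
    set xs \<subseteq> WJ_af D (stab_nodes D lam) \<and>
    sorted_wrt (\<lambda>x y. si_less D (stab_nodes D lam) y x) xs \<and>
    rat_chain (length xs) as \<and>
    (\<forall>u\<in>{1..<length xs}. sib_path D lam (as ! u) (xs ! u) (xs ! (u - 1)))}"


section \<open>Lakshmibai-Seshadri paths\<close>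

definition orbit :: "('i, 'p::ab_group_add) affine \<Rightarrow> 'p \<Rightarrow> 'p set"
  where "orbit D lam = {x lam | x. x \<in> W_af D}"

definition ls_le :: "('i::finite, 'p::ab_group_add) affine \<Rightarrow> 'p \<Rightarrow> 'p \<Rightarrow> 'p \<Rightarrow> bool"
  where "ls_le D lam =
    (\<lambda>\<mu> \<nu>. \<mu> \<in> orbit D lam \<and> \<nu> \<in> orbit D lam \<and>
       (\<exists>\<beta>\<in>pos_real_roots D. \<nu> = refl D \<beta> \<mu> \<and> 0 < coroot D \<beta> \<mu>))\<^sup>*\<^sup>*"

definition ls_less :: "('i::finite, 'p::ab_group_add) affine \<Rightarrow> 'p \<Rightarrow> 'p \<Rightarrow> 'p \<Rightarrow> bool"
  where "ls_less D lam \<mu> \<nu> \<longleftrightarrow> ls_le D lam \<mu> \<nu> \<and> \<mu> \<noteq> \<nu>"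

definition ls_covers :: "('i::finite, 'p::ab_group_add) affine \<Rightarrow> 'p \<Rightarrow> 'p \<Rightarrow> 'p \<Rightarrow> bool"
  where "ls_covers D lam \<mu> \<nu> \<longleftrightarrow>
    \<mu> \<in> orbit D lam \<and> \<nu> \<in> orbit D lam \<and> ls_less D lam \<mu> \<nu> \<and>
    \<not> (\<exists>\<kappa>\<in>orbit D lam. ls_less D lam \<mu> \<kappa> \<and> ls_less D lam \<kappa> \<nu>)"

definition lz_edge :: "('i::finite, 'p::ab_group_add) affine \<Rightarrow> 'p \<Rightarrow> 'p \<Rightarrow> 'p \<Rightarrow> 'p \<Rightarrow> bool"
  where "lz_edge D lam \<mu> \<beta> \<nu> \<longleftrightarrow>
    ls_covers D lam \<mu> \<nu> \<and> \<beta> \<in> pos_real_roots D \<and> \<nu> = refl D \<beta> \<mu> \<and> 0 < coroot D \<beta> \<mu>"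

text \<open>Existence of a directed path in \<open>LZ(\<lambda>; a)\<close>.\<close>

definition lz_path :: "('i::finite, 'p::ab_group_add) affine \<Rightarrow> 'p \<Rightarrow> rat \<Rightarrow> 'p \<Rightarrow> 'p \<Rightarrow> bool"
  where "lz_path D lam a =
    (\<lambda>\<mu> \<nu>. \<exists>\<beta>. lz_edge D lam \<mu> \<beta> \<nu> \<and> a * of_int (coroot D \<beta> \<mu>) \<in> \<int>)\<^sup>*\<^sup>*"

definition LS :: "('i::finite, 'p::ab_group_add) affine \<Rightarrow> 'p \<Rightarrow> ('p list \<times> rat list) set"
  where "LS D lam = {(\<nu>s, as).
    set \<nu>s \<subseteq> orbit D lam \<and>
    sorted_wrt (\<lambda>\<mu> \<nu>. ls_less D lam \<nu> \<mu>) \<nu>s \<and>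
    rat_chain (length \<nu>s) as \<and>
    (\<forall>u\<in>{1..<length \<nu>s}. lz_path D lam (as ! u) (\<nu>s ! u) (\<nu>s ! (u - 1)))}"

end

theory Submission
  imports Defs
begin

text \<open>
  For \<open>x \<in> W\<^sub>a\<^sub>f\<close> let \<open>len x\<close> be the sum, over the positive roots \<open>\<alpha>\<close> outside \<open>\<Delta>\<^sub>J\<close>, of the least \<open>m\<close> with
  \<open>x \<alpha> + m \<delta>\<close> positive. On \<open>(W\<^sup>J)\<^sub>a\<^sub>f\<close> it is the semi-infinite length, and on all of \<open>W\<^sub>a\<^sub>f\<close> it satisfies
  \<open>len (r\<^sub>j x) = len x + sgn \<langle>\<alpha>\<^sub>j\<^sup>\<or>, x \<lambda>\<rangle>\<close>. Every positive real root \<open>\<beta>\<close> that is not simple has a simple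
  root \<open>\<alpha>\<^sub>j\<close> with \<open>\<langle>\<alpha>\<^sub>j\<^sup>\<or>, \<beta>\<rangle> > 0\<close>, and conjugating by \<open>r\<^sub>j\<close> lowers its height. Put
  \<open>u = \<langle>\<alpha>\<^sub>j\<^sup>\<or>, x \<lambda>\<rangle>\<close>, \<open>v = \<langle>\<alpha>\<^sub>j\<^sup>\<or>, r\<^sub>\<beta> x \<lambda>\<rangle>\<close> and suppose \<open>\<langle>\<beta>\<^sup>\<or>, x \<lambda>\<rangle> > 0\<close>, so that \<open>v < u\<close>. Induction on
  the height gives \<open>len (r\<^sub>\<beta> x) > len x\<close>, and a length increase of exactly one forces \<open>sgn u = sgn v \<noteq> 0\<close>. In
  that case a cover between \<open>r\<^sub>j x \<lambda>\<close> and \<open>r\<^sub>j r\<^sub>\<beta> x \<lambda>\<close> gives one between \<open>x \<lambda>\<close> and \<open>r\<^sub>\<beta> x \<lambda>\<close>, because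
  \<open>\<mu> \<le> \<nu>\<close> implies \<open>r\<^sub>j \<mu> \<le> r\<^sub>j \<nu>\<close> or both \<open>r\<^sub>j \<mu> \<le> \<nu>\<close> and \<open>\<mu> \<le> r\<^sub>j \<nu>\<close>. For simple \<open>\<beta>\<close> the cover is clear.
  Hence edges of \<open>SiB\<close> map to edges of \<open>LZ\<close> with the same label, although \<open>x \<mapsto> x \<lambda>\<close> need not be
  injective on \<open>(W\<^sup>J)\<^sub>a\<^sub>f\<close>.
\<close>

section \<open>Root systems of untwisted affine data\<close>

lemma additive_int_scale:
  fixes h :: "'p::ab_group_add \<Rightarrow> 'q::ab_group_add"
  assumes "additive h"
  shows "h (k \<cdot> x) = k \<cdot> h x"
  using assms by (simp add: int_scale_def additive.diff additive.sum)

lemma int_scale_int [simp]: "k \<cdot> (m::int) = k * m"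
  by (simp add: int_scale_def algebra_simps flip: left_diff_distrib)

lemma additive_compose:
  "additive f \<Longrightarrow> additive g \<Longrightarrow> additive (f \<circ> g)"
  by (simp add: additive_def)

lemma refl_word_Nil [simp]: "refl_word D [] = id"
  by (simp add: refl_word_def)

lemma refl_word_Cons [simp]: "refl_word D (i # is) = srefl D i \<circ> refl_word D is"
  by (simp add: refl_word_def)

lemma refl_word_append: "refl_word D (is @ js) = refl_word D is \<circ> refl_word D js"
  by (induction "is") auto

lemma weyl_gen_id: "id \<in> weyl_gen D K"
  unfolding weyl_gen_def by (rule image_eqI [of _ _ "[]"]) auto

lemma weyl_gen_srefl: "i \<in> K \<Longrightarrow> srefl D i \<in> weyl_gen D K"
  unfolding weyl_gen_def by (rule image_eqI [of _ _ "[i]"]) auto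

lemma weyl_gen_comp: "v \<in> weyl_gen D K \<Longrightarrow> w \<in> weyl_gen D K \<Longrightarrow> v \<circ> w \<in> weyl_gen D K"
  unfolding weyl_gen_def by (clarsimp simp flip: refl_word_append) (rule imageI, auto)

lemma weyl_gen_induct [consumes 1, case_names id srefl]:
  assumes "w \<in> weyl_gen D K" "P id"
    "\<And>i w. i \<in> K \<Longrightarrow> w \<in> weyl_gen D K \<Longrightarrow> P w \<Longrightarrow> P (srefl D i \<circ> w)"
  shows "P w"
proof -
  obtain "is" where "is": "is \<in> lists K" and w: "w = refl_word D is"
    using assms(1) by (auto simp: weyl_gen_def)
  from "is" have "P (refl_word D is)"
  proof (induction "is")
    case Nil
    then show ?case using assms(2) by (simp only: refl_word_Nil)
  next
    case (Cons i "is")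
    then have "P (srefl D i \<circ> refl_word D is)" by (intro assms(3)) (auto simp: weyl_gen_def)
    then show ?case by (simp only: refl_word_Cons)
  qed
  then show ?thesis by (simp add: w)
qed

lemma weyl_gen_mono: "K \<subseteq> L \<Longrightarrow> weyl_gen D K \<subseteq> weyl_gen D L"
  unfolding weyl_gen_def by (intro image_mono lists_mono)

section \<open>A maximum principle for matrices of affine type\<close>

text \<open>A positive maximum \<open>t\<close> of \<open>k / u\<close> is attained on a set
  \<open>K\<close> avoiding \<open>z\<close>, and connectedness joins some \<open>i\<close> in
  \<open>K\<close> to some \<open>l\<close> outside. Row \<open>i\<close> annihilates
  \<open>d = t * u - k\<close>, which is nonnegative and zero at \<open>i\<close>, so every term of
  that row vanishes although \<open>d l > 0\<close>. This is the source of the nondegeneracy of the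
  finite Cartan matrix.\<close>

lemma max_principle_pos:
  fixes M :: "'i::finite \<Rightarrow> 'i \<Rightarrow> int" and u k :: "'i \<Rightarrow> int"
  assumes off: "\<And>i j. i \<noteq> j \<Longrightarrow> M i j \<le> 0"
    and conn: "\<And>K. K \<noteq> {} \<Longrightarrow> K \<noteq> UNIV \<Longrightarrow> \<exists>i\<in>K. \<exists>j\<in>-K. M i j \<noteq> 0"
    and u: "\<And>i. 0 < u i" "\<And>i. (\<Sum>j\<in>UNIV. M i j * u j) = 0"
    and k: "k z = 0" "\<And>i. i \<noteq> z \<Longrightarrow> (\<Sum>j\<in>UNIV. M i j * k j) = 0"
  shows "k j \<le> 0"
proof (rule ccontr)
  assume "\<not> k j \<le> 0"
  then have kj: "0 < k j" by simp
  define q where "q = (\<lambda>i. of_int (k i) / (of_int (u i) :: rat))"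
  define t where "t = Max (range q)"
  define K where "K = {i. q i = t}"
  have tmax: "q i \<le> t" for i unfolding t_def by (rule Max_ge) auto
  have "0 < q j" using kj u(1)[of j] by (simp add: q_def)
  then have tpos: "0 < t" using tmax[of j] by simp
  have "t \<in> range q" unfolding t_def by (rule Max_in) auto
  then have "K \<noteq> {}" by (auto simp: K_def)
  moreover have zK: "z \<notin> K" using k(1) tpos by (auto simp: K_def q_def)
  ultimately obtain i l where il: "i \<in> K" "l \<notin> K" "M i l \<noteq> 0"
    using conn[of K] by blast
  have iz: "i \<noteq> z" using il zK by auto
  define d where "d = (\<lambda>m. t * of_int (u m) - of_int (k m))"
  have d0: "0 \<le> d m" for m
    using tmax[of m] u(1)[of m] by (simp add: d_def q_def field_simps)
  have di: "d i = 0"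
    using il(1) u(1)[of i] by (auto simp: d_def K_def q_def field_simps)
  have dl: "0 < d l"
    using il(2) tmax[of l] u(1)[of l]
    by (auto simp: d_def K_def q_def field_simps order.strict_iff_order)
  have "(\<Sum>m\<in>UNIV. of_int (M i m) * d m) =
      t * of_int (\<Sum>m\<in>UNIV. M i m * u m) - of_int (\<Sum>m\<in>UNIV. M i m * k m)"
    by (simp add: d_def sum_subtractf sum_distrib_left algebra_simps)
  also have "\<dots> = 0" using u(2) k(2)[OF iz] by simp
  finally have "(\<Sum>m\<in>UNIV. - of_int (M i m) * d m) = 0"
    by (simp add: sum_negf)
  moreover have "0 \<le> - of_int (M i m) * d m" for m
    using off[of i m] d0[of m] di by (cases "m = i") (auto simp: mult_nonpos_nonneg)
  ultimately have "- of_int (M i l) * d l = 0"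
    by (subst (asm) sum_nonneg_eq_0_iff) auto
  then show False using il dl by simp
qed

lemma max_principle:
  fixes M :: "'i::finite \<Rightarrow> 'i \<Rightarrow> int" and u k :: "'i \<Rightarrow> int"
  assumes "\<And>i j. i \<noteq> j \<Longrightarrow> M i j \<le> 0"
    and "\<And>K. K \<noteq> {} \<Longrightarrow> K \<noteq> UNIV \<Longrightarrow> \<exists>i\<in>K. \<exists>j\<in>-K. M i j \<noteq> 0"
    and "\<And>i. 0 < u i" "\<And>i. (\<Sum>j\<in>UNIV. M i j * u j) = 0"
    and "k z = 0" "\<And>i. i \<noteq> z \<Longrightarrow> (\<Sum>j\<in>UNIV. M i j * k j) = 0"
  shows "k j = 0"
proof -
  have "k j \<le> 0"
    by (rule max_principle_pos [of M u k z]) (use assms in auto)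
  moreover have "- k j \<le> 0"
    by (rule max_principle_pos [of M u "\<lambda>j. - k j" z]) (use assms in \<open>auto simp: sum_negf\<close>)
  ultimately show ?thesis by simp
qed

locale untwisted =
  fixes D :: "('i::finite, 'p::ab_group_add) affine"
  assumes untwisted: "untwisted_affine D"
begin

abbreviation "z0 \<equiv> node0 D"
abbreviation "I \<equiv> fin_nodes D"
abbreviation "al \<equiv> sroot D"
abbreviation "ac \<equiv> scoroot D"
abbreviation "A \<equiv> cartan D"
abbreviation "s \<equiv> srefl D"
abbreviation "dl \<equiv> null_root D"
abbreviation "a \<equiv> mark D"
abbreviation "av \<equiv> comark D"
abbreviation "\<Lambda> \<equiv> fweight D"

lemma in_I: "i \<in> I \<longleftrightarrow> i \<noteq> z0"
  by (simp add: fin_nodes_def)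

lemma o_notin_I [simp]: "z0 \<notin> I"
  by (simp add: in_I)

lemma UNIV_split: "(UNIV :: 'i set) = insert z0 I"
  by (auto simp: in_I)

lemma lattice: "weight_lattice D" and cartan_affine: "affine_cartan D"
  and theta_root: "dl - al z0 \<in> fin_roots D"
  and theta_highest: "\<alpha> \<in> fin_roots D \<Longrightarrow> dl - al z0 - \<alpha> \<in> root_cone D I"
  using untwisted unfolding untwisted_affine_def by simp_all

lemma ac_additive: "additive (ac i)"
  and inj_al: "inj al"
  and indep_al: "int_module.independent (range al)"
  and ac_fweight: "ac i (\<Lambda> j) = (if i = j then 1 else 0)"
  using lattice unfolding weight_lattice_def by simp_all

lemma A_diag [simp]: "A i i = 2"
  and A_off: "i \<noteq> j \<Longrightarrow> A i j \<le> 0"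
  and A_zero: "A i j = 0 \<Longrightarrow> A j i = 0"
  and A_conn: "K \<noteq> {} \<Longrightarrow> K \<noteq> UNIV \<Longrightarrow> \<exists>i\<in>K. \<exists>j\<in>-K. A i j \<noteq> 0"
  and a_pos: "0 < a i"
  and av_pos: "0 < av i"
  and A_a: "(\<Sum>j\<in>UNIV. A i j * a j) = 0"
  and av_A: "(\<Sum>i\<in>UNIV. av i * A i j) = 0"
  and a_o [simp]: "a z0 = 1"
  and av_o [simp]: "av z0 = 1"
  using cartan_affine unfolding affine_cartan_def by simp_all

lemmas ac_add [simp] = additive.add [OF ac_additive]
  and ac_diff [simp] = additive.diff [OF ac_additive]
  and ac_minus [simp] = additive.minus [OF ac_additive]
  and ac_zero [simp] = additive.zero [OF ac_additive]
  and ac_sum = additive.sum [OF ac_additive]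

lemma ac_scale [simp]: "ac i (k \<cdot> x) = k * ac i x"
  using additive_int_scale [OF ac_additive] by simp

lemma ac_al: "ac i (al j) = A i j"
  by (simp add: cartan_def)

lemma ac_al_same [simp]: "ac i (al i) = 2"
  by (simp add: ac_al)

lemma A_nondeg:
  assumes "k z0 = 0" "\<And>i. i \<in> I \<Longrightarrow> (\<Sum>j\<in>UNIV. A i j * k j) = 0"
  shows "k j = 0"
  by (rule max_principle [of A a k z0]) (use assms A_off A_conn a_pos A_a in_I in auto)

text \<open>The transposed matrix has the comarks as positive null vector and, by
  \<open>A_zero\<close>, the same connectedness.\<close>

lemma A_nondeg_transpose:
  assumes "k z0 = 0" "\<And>j. j \<in> I \<Longrightarrow> (\<Sum>i\<in>UNIV. k i * A i j) = 0"
  shows "k j = 0"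
proof (rule max_principle [of "\<lambda>i j. A j i" av k z0])
  show "\<exists>i\<in>K. \<exists>j\<in>-K. A j i \<noteq> 0" if "K \<noteq> {}" "K \<noteq> UNIV" for K
    using A_conn [OF that] A_zero by blast
qed (use assms A_off av_pos av_A in_I in \<open>auto simp: mult.commute\<close>)

lemma s_additive: "additive (s i)"
  by (simp add: additive_def srefl_def int_scale_add_left algebra_simps)

lemmas s_add = additive.add [OF s_additive]
  and s_diff = additive.diff [OF s_additive]
  and s_minus [simp] = additive.minus [OF s_additive]
  and s_zero [simp] = additive.zero [OF s_additive]

lemma s_scale: "s i (k \<cdot> x) = k \<cdot> s i x"
  by (rule additive_int_scale [OF s_additive])

lemma s_al [simp]: "s i (al i) = - al i"
proof -
  have "2 \<cdot> al i = al i + al i"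
    using int_scale_add_left [of 1 1 "al i"] by (simp add: int_scale_one)
  then show ?thesis by (simp add: srefl_def)
qed

lemma s_s [simp]: "s i (s i x) = x"
proof -
  have "s i (s i x) = s i x - ac i x \<cdot> s i (al i)"
    by (simp add: srefl_def [of D i x] s_diff s_scale)
  then show ?thesis by (simp add: srefl_def int_scale_one)
qed

lemma ac_s: "ac i (s i x) = - ac i x"
  by (simp add: srefl_def)

lemma weyl_additive:
  assumes "w \<in> weyl_gen D K" shows "additive w"
  using assms
proof (induction rule: weyl_gen_induct)
  case id
  then show ?case by (simp add: additive_def)
next
  case (srefl i w)
  then show ?case by (intro additive_compose s_additive)
qed

lemma weyl_inverse:
  assumes "w \<in> weyl_gen D K"
  obtains v where "v \<in> weyl_gen D K" "\<And>x. v (w x) = x" "\<And>x. w (v x) = x"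
proof -
  have "\<exists>v\<in>weyl_gen D K. (\<forall>x. v (w x) = x) \<and> (\<forall>x. w (v x) = x)"
    using assms
  proof (induction rule: weyl_gen_induct)
    case id
    show ?case by (rule bexI [OF _ weyl_gen_id]) simp
  next
    case (srefl i w)
    then obtain v where v: "v\<in>weyl_gen D K" "\<forall>x. v (w x) = x" "\<forall>x. w (v x) = x" by blast
    show ?case
      by (rule bexI [of _ "v \<circ> s i"]) (use v srefl in \<open>auto intro: weyl_gen_comp weyl_gen_srefl\<close>)
  qed
  then show thesis using that by blast
qed

lemma weyl_inj: "w \<in> weyl_gen D K \<Longrightarrow> w x = w y \<Longrightarrow> x = y"
  by (metis weyl_inverse)

lemma W_fin_sub: "W_fin D \<subseteq> W_af D"
  unfolding W_fin_def W_af_def by (rule weyl_gen_mono) auto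

section \<open>Coordinates on the root lattice\<close>

definition rl :: "('i \<Rightarrow> int) \<Rightarrow> 'p"
  where "rl k = (\<Sum>i\<in>UNIV. k i \<cdot> al i)"

lemma rl_add: "rl (\<lambda>i. k i + l i) = rl k + rl l"
  by (simp add: rl_def int_scale_add_left sum.distrib)

lemma rl_scale: "rl (\<lambda>i. n * k i) = n \<cdot> rl k"
  by (simp add: rl_def int_module.scale_sum_right)

lemma rl_diff: "rl (\<lambda>i. k i - l i) = rl k - rl l"
  by (simp add: rl_def int_module.scale_left_diff_distrib sum_subtractf)

lemma rl_single: "rl (\<lambda>i. if i = j then n else 0) = n \<cdot> al j"
  unfolding rl_def by (simp add: if_distrib [of "\<lambda>n. n \<cdot> _"] cong: if_cong)

lemma rl_eq_0: assumes "rl k = 0" shows "k = (\<lambda>_. 0)"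
proof
  fix j
  \<comment> \<open>Independence is stated for a set of vectors, so \<open>u\<close> carries the
    coefficients from the indices over to the simple roots.\<close>
  define u where "u = (\<lambda>x. k (inv al x))"
  have "(\<Sum>x\<in>range al. u x \<cdot> x) = 0"
    using assms inj_al by (simp add: sum.reindex u_def rl_def)
  then have "u (al j) = 0"
    using int_module.independentD [OF indep_al, where t = "range al" and u = u and v = "al j"] by simp
  then show "k j = 0" by (simp add: u_def inj_al)
qed

lemma inj_rl: "inj rl"
proof (rule injI)
  fix k l assume "rl k = rl l"
  then have "rl (\<lambda>i. k i - l i) = 0" by (simp add: rl_diff)
  then have "k i - l i = 0" for i by (drule_tac rl_eq_0) meson
  then show "k = l" by (intro ext) simp
qed

text \<open>The simple-root coefficients. They are meaningful on \<open>Q\<close> only, since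
  \<open>inv\<close> is arbitrary elsewhere; hence the premises \<open>x \<in> Q\<close>
  below.\<close>

definition cf :: "'p \<Rightarrow> 'i \<Rightarrow> int"
  where "cf = inv rl"

definition Q :: "'p set"
  where "Q = range rl"

lemma cf_rl [simp]: "cf (rl k) = k"
  by (simp add: cf_def inj_rl)

lemma rl_cf [simp]: "x \<in> Q \<Longrightarrow> rl (cf x) = x"
  by (auto simp: Q_def)

lemma rl_in_Q [simp]: "rl k \<in> Q"
  by (simp add: Q_def)

lemma al_in_Q [simp]: "al i \<in> Q"
  using rl_in_Q [of "\<lambda>j. if j = i then 1 else 0"] by (simp add: rl_single int_scale_one)

lemma cf_al: "cf (al j) i = (if i = j then 1 else 0)"
  using cf_rl [of "\<lambda>i. if i = j then 1 else 0"] by (simp add: rl_single int_scale_one)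

lemma Q_add [simp]: "x \<in> Q \<Longrightarrow> y \<in> Q \<Longrightarrow> x + y \<in> Q"
  and cf_add: "x \<in> Q \<Longrightarrow> y \<in> Q \<Longrightarrow> cf (x + y) i = cf x i + cf y i"
  unfolding Q_def by (auto simp flip: rl_add)

lemma Q_diff [simp]: "x \<in> Q \<Longrightarrow> y \<in> Q \<Longrightarrow> x - y \<in> Q"
  and cf_diff: "x \<in> Q \<Longrightarrow> y \<in> Q \<Longrightarrow> cf (x - y) i = cf x i - cf y i"
  unfolding Q_def by (auto simp flip: rl_diff)

lemma Q_scale [simp]: "x \<in> Q \<Longrightarrow> n \<cdot> x \<in> Q"
  and cf_scale: "x \<in> Q \<Longrightarrow> cf (n \<cdot> x) i = n * cf x i"
  unfolding Q_def by (auto simp flip: rl_scale)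

lemma Q_minus [simp]: "x \<in> Q \<Longrightarrow> - x \<in> Q"
  and cf_minus: "x \<in> Q \<Longrightarrow> cf (- x) i = - cf x i"
  using Q_scale [of x "-1"] cf_scale [of x "-1"] by (simp_all add: int_scale_minus int_scale_one)

lemma Q_zero [simp]: "0 \<in> Q" and cf_zero [simp]: "cf 0 i = 0"
  using Q_diff [of "al z0" "al z0"] cf_diff [of "al z0" "al z0"] by auto

lemma cf_eqI: "x \<in> Q \<Longrightarrow> y \<in> Q \<Longrightarrow> (\<And>i. cf x i = cf y i) \<Longrightarrow> x = y"
  by (metis ext rl_cf)

lemma Q_s [simp]: "x \<in> Q \<Longrightarrow> s j x \<in> Q"
  and cf_s: "x \<in> Q \<Longrightarrow> cf (s j x) i = cf x i - (if i = j then ac j x else 0)"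
  by (simp_all add: srefl_def cf_diff cf_scale cf_al)

lemma dl_rl: "dl = rl a"
  by (simp add: null_root_def rl_def)

lemma Q_dl [simp]: "dl \<in> Q" and cf_dl [simp]: "cf dl i = a i"
  by (simp_all add: dl_rl)

lemma ac_rl: "ac i (rl k) = (\<Sum>j\<in>UNIV. A i j * k j)"
  by (simp add: rl_def ac_sum ac_al mult.commute)

lemma ac_dl [simp]: "ac i dl = 0"
  by (simp add: dl_rl ac_rl A_a)

lemma s_dl [simp]: "s i dl = dl"
  by (simp add: srefl_def)

lemma root_cone_I: "root_cone D I = {x \<in> Q. cf x z0 = 0 \<and> (\<forall>i. 0 \<le> cf x i)}"
proof -
  have *: "(\<Sum>i\<in>I. k i \<cdot> al i) = rl (\<lambda>i. if i = z0 then 0 else k i)" for k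
    unfolding rl_def by (intro sum.mono_neutral_cong_left) (auto simp: in_I)
  have "x \<in> root_cone D I" if "x \<in> Q" "cf x z0 = 0" "\<forall>i. 0 \<le> cf x i" for x
  proof -
    have "(\<lambda>i. if i = z0 then 0 else int (nat (cf x i))) = cf x" using that by auto
    then have "x = (\<Sum>i\<in>I. int (nat (cf x i)) \<cdot> al i)" using that(1) by (simp only: * rl_cf)
    then show ?thesis unfolding root_cone_def by (intro CollectI exI [of _ "\<lambda>i. nat (cf x i)"]) simp
  qed
  then show ?thesis by (auto simp: root_cone_def *)
qed

subsection \<open>The finite root system\<close>

abbreviation "Wf \<equiv> W_fin D"
abbreviation "\<Phi> \<equiv> fin_roots D"
abbreviation "\<Phi>p \<equiv> pos_fin_roots D"

lemmas Wf_id = weyl_gen_id [of D I, folded W_fin_def]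
  and Wf_s = weyl_gen_srefl [of _ I D, folded W_fin_def]
  and Wf_comp = weyl_gen_comp [of _ D I, folded W_fin_def]
  and Wf_induct = weyl_gen_induct [of _ D I, folded W_fin_def, consumes 1, case_names id srefl]
  and Wf_additive = weyl_additive [of _ I, folded W_fin_def]
  and Wf_inverse = weyl_inverse [of _ I, folded W_fin_def]
  and Wf_inj = weyl_inj [of _ I, folded W_fin_def]

lemmas Wf_minus = additive.minus [OF Wf_additive]
  and Wf_diff = additive.diff [OF Wf_additive]
  and Wf_scale = additive_int_scale [OF Wf_additive]

lemma weyl_Q: "w \<in> weyl_gen D K \<Longrightarrow> x \<in> Q \<Longrightarrow> w x \<in> Q"
  by (induction arbitrary: x rule: weyl_gen_induct) auto

lemma weyl_dl: "w \<in> weyl_gen D K \<Longrightarrow> w dl = dl"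
  by (induction rule: weyl_gen_induct) auto

lemma cf_Wf: "w \<in> Wf \<Longrightarrow> x \<in> Q \<Longrightarrow> cf (w x) z0 = cf x z0"
proof (induction arbitrary: x rule: Wf_induct)
  case (srefl i w)
  then have "w x \<in> Q" by (auto simp: W_fin_def intro: weyl_Q)
  then show ?case using srefl by (auto simp: cf_s)
qed auto

lemma Phi_al: "i \<in> I \<Longrightarrow> al i \<in> \<Phi>"
  unfolding fin_roots_def by (intro CollectI exI [of _ id] exI [of _ i]) (simp add: Wf_id)

lemma Phi_Wf: "w \<in> Wf \<Longrightarrow> \<alpha> \<in> \<Phi> \<Longrightarrow> w \<alpha> \<in> \<Phi>"
  unfolding fin_roots_def using Wf_comp [of w] by (force simp: o_def)

lemma Phi_s: "i \<in> I \<Longrightarrow> \<alpha> \<in> \<Phi> \<Longrightarrow> s i \<alpha> \<in> \<Phi>"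
  by (rule Phi_Wf [OF Wf_s])

lemma Phi_minus: "\<alpha> \<in> \<Phi> \<Longrightarrow> - \<alpha> \<in> \<Phi>"
proof -
  assume "\<alpha> \<in> \<Phi>"
  then obtain w i where "w \<in> Wf" "i \<in> I" "\<alpha> = w (al i)" by (auto simp: fin_roots_def)
  then show "- \<alpha> \<in> \<Phi>"
    using Phi_Wf [of w "s i (al i)"] Phi_s [of i "al i"] Phi_al [of i] by (simp add: Wf_minus)
qed

lemma Phi_Q [simp]: "\<alpha> \<in> \<Phi> \<Longrightarrow> \<alpha> \<in> Q"
  by (auto simp: fin_roots_def W_fin_def intro: weyl_Q)

lemma Phi_cf: "\<alpha> \<in> \<Phi> \<Longrightarrow> cf \<alpha> z0 = 0"
  by (auto simp: fin_roots_def cf_Wf cf_al)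

text \<open>The highest root \<theta> of the finite system; that it is one is exactly the
  untwistedness condition.\<close>

definition th :: 'p
  where "th = dl - al z0"

lemma th_Phi: "th \<in> \<Phi>"
  using theta_root by (simp add: th_def)

lemma th_Q [simp]: "th \<in> Q"
  by (simp add: th_def)

lemma cf_th: "cf th i = (if i = z0 then 0 else a i)"
  by (simp add: th_def cf_diff cf_al)

lemma Phi_le_th: "\<alpha> \<in> \<Phi> \<Longrightarrow> cf \<alpha> i \<le> cf th i"
  using theta_highest [of \<alpha>] by (simp add: root_cone_I cf_diff flip: th_def)

text \<open>Both \<alpha> and -\<alpha> lie below \<theta>, whose coefficients are the marks.
  Finiteness of \<Phi> follows.\<close>

lemma Phi_bound: "\<alpha> \<in> \<Phi> \<Longrightarrow> \<bar>cf \<alpha> i\<bar> \<le> a i"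
  using Phi_le_th [of \<alpha> i] Phi_le_th [of "- \<alpha>" i] a_pos [of i] Phi_minus [of \<alpha>]
  by (auto simp: cf_minus cf_th split: if_splits)

lemma finite_Phi: "finite \<Phi>"
proof (rule finite_subset)
  show "\<Phi> \<subseteq> rl ` PiE UNIV (\<lambda>i. {- a i..a i})"
  proof
    fix \<alpha> assume "\<alpha> \<in> \<Phi>"
    then have "\<alpha> = rl (cf \<alpha>)" "cf \<alpha> \<in> PiE UNIV (\<lambda>i. {- a i..a i})"
      using Phi_bound [of \<alpha>] by (auto simp: abs_le_iff) (smt (verit) Phi_bound abs_le_iff)+
    then show "\<alpha> \<in> rl ` PiE UNIV (\<lambda>i. {- a i..a i})" by blast
  qed
  show "finite (rl ` PiE UNIV (\<lambda>i. {- a i..a i}))"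
    by (intro finite_imageI finite_PiE) auto
qed

text \<open>The simple roots need not span the weight lattice. Writing \<open>w - 1\<close> through
  simple roots and simple coroots with one integer matrix \<open>G\<close> lets the action on roots
  control the action on all weights.\<close>

lemma Wf_displacement:
  assumes "w \<in> Wf"
  obtains G where "\<And>\<mu>. w \<mu> = \<mu> + rl (\<lambda>i. \<Sum>j\<in>UNIV. G i j * ac j \<mu>)"
    and "\<And>i. G i z0 = 0"
proof -
  have "\<exists>G. (\<forall>\<mu>. w \<mu> = \<mu> + rl (\<lambda>i. \<Sum>j\<in>UNIV. G i j * ac j \<mu>)) \<and> (\<forall>i. G i z0 = 0)"
    using assms
  proof (induction rule: Wf_induct)
    case id
    have "rl (\<lambda>_. 0) = 0" by (simp add: rl_def)
    then show ?case by (intro exI [of _ "\<lambda>_ _. 0"]) simp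
  next
    case (srefl k w)
    then obtain G where G: "\<And>\<mu>. w \<mu> = \<mu> + rl (\<lambda>i. \<Sum>j\<in>UNIV. G i j * ac j \<mu>)"
      "\<And>i. G i z0 = 0" by blast
    \<comment> \<open>\<open>H j\<close> is the coefficient of \<open>ac j\<close> in the functional
      \<open>ac k \<circ> w\<close>.\<close>
    define H where "H = (\<lambda>j. (if j = k then 1 else 0) + (\<Sum>l\<in>UNIV. A k l * G l j))"
    have acw: "ac k (w \<mu>) = (\<Sum>j\<in>UNIV. H j * ac j \<mu>)" for \<mu>
    proof -
      have "ac k (w \<mu>) = ac k \<mu> + (\<Sum>l\<in>UNIV. A k l * (\<Sum>j\<in>UNIV. G l j * ac j \<mu>))"
        by (simp add: G(1) ac_rl)
      also have "(\<Sum>l\<in>UNIV. A k l * (\<Sum>j\<in>UNIV. G l j * ac j \<mu>)) =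
          (\<Sum>j\<in>UNIV. (\<Sum>l\<in>UNIV. A k l * G l j) * ac j \<mu>)"
        unfolding sum_distrib_left sum_distrib_right mult.assoc by (rule sum.swap)
      also have "ac k \<mu> = (\<Sum>j\<in>UNIV. (if j = k then 1 else 0) * ac j \<mu>)"
        by (simp add: if_distrib [of "\<lambda>n. n * _"] cong: if_cong)
      finally show ?thesis by (simp add: H_def distrib_right sum.distrib)
    qed
    define G' where "G' = (\<lambda>i j. G i j - (if i = k then H j else 0))"
    have "(s k \<circ> w) \<mu> = \<mu> + rl (\<lambda>i. \<Sum>j\<in>UNIV. G' i j * ac j \<mu>)" for \<mu>
    proof -
      have "(s k \<circ> w) \<mu> = w \<mu> - (\<Sum>j\<in>UNIV. H j * ac j \<mu>) \<cdot> al k"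
        by (simp add: srefl_def acw)
      also have "\<dots> = \<mu> + rl (\<lambda>i. (\<Sum>j\<in>UNIV. G i j * ac j \<mu>) -
          (if i = k then (\<Sum>j\<in>UNIV. H j * ac j \<mu>) else 0))"
        by (simp add: rl_diff rl_single G(1))
      also have "(\<lambda>i. (\<Sum>j\<in>UNIV. G i j * ac j \<mu>) -
          (if i = k then (\<Sum>j\<in>UNIV. H j * ac j \<mu>) else 0)) = (\<lambda>i. \<Sum>j\<in>UNIV. G' i j * ac j \<mu>)"
        by (auto simp: G'_def left_diff_distrib sum_subtractf)
      finally show ?thesis .
    qed
    moreover have "G' i z0 = 0" for i
      using srefl(1) G(2) by (auto simp: G'_def H_def)
    ultimately show ?case by blast
  qed
  then show thesis using that by blast
qed

text \<open>Fixing the simple roots makes every row of \<open>G\<close> annihilate the columns of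
  \<open>A\<close> indexed by \<open>I\<close>; since its entry at \<open>z0\<close> is zero,
  \<open>A_nondeg_transpose\<close> forces the row to vanish.\<close>

lemma Wf_faithful:
  assumes w: "w \<in> Wf" and fixed: "\<And>i. i \<in> I \<Longrightarrow> w (al i) = al i"
  shows "w = id"
proof -
  obtain G where G: "\<And>\<mu>. w \<mu> = \<mu> + rl (\<lambda>i. \<Sum>j\<in>UNIV. G i j * ac j \<mu>)"
    and G0: "\<And>i. G i z0 = 0"
    by (rule Wf_displacement [OF w]) blast
  have "(\<Sum>j\<in>UNIV. G i j * A j k) = 0" if "k \<in> I" for i k
  proof -
    have "rl (\<lambda>i. \<Sum>j\<in>UNIV. G i j * A j k) = 0"
      using fixed [OF that] G [of "al k"] by (simp add: ac_al)
    from rl_eq_0 [OF this] show ?thesis by meson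
  qed
  then have "G i j = 0" for i j
    using A_nondeg_transpose [of "G i"] G0 by blast
  then have "w \<mu> = \<mu>" for \<mu> using G [of \<mu>] by (simp add: rl_def)
  then show ?thesis by auto
qed

lemma Wf_eqI:
  assumes w: "w \<in> Wf" "v \<in> Wf" and eq: "\<And>i. i \<in> I \<Longrightarrow> w (al i) = v (al i)"
  shows "w = v"
proof -
  obtain v' where v': "v' \<in> Wf" "\<And>x. v' (v x) = x" "\<And>x. v (v' x) = x"
    using Wf_inverse [OF w(2)] by blast
  have "v' \<circ> w = id"
    by (rule Wf_faithful) (use v' w eq in \<open>auto intro: Wf_comp\<close>)
  then have "v (v' (w x)) = v x" for x by (metis comp_apply id_apply)
  then show ?thesis using v' by auto
qed

lemma finite_Wf: "finite Wf"
proof (rule finite_imageD)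
  let ?f = "\<lambda>w i. if i \<in> I then w (al i) else 0"
  have "?f ` Wf \<subseteq> PiE UNIV (\<lambda>_. insert 0 \<Phi>)"
    using Phi_Wf Phi_al by auto
  then show "finite (?f ` Wf)"
    by (rule finite_subset) (intro finite_PiE, auto simp: finite_Phi)
  show "inj_on ?f Wf"
  proof (rule inj_onI)
    fix w v assume "w \<in> Wf" "v \<in> Wf" and eq: "?f w = ?f v"
    moreover have "w (al i) = v (al i)" if "i \<in> I" for i
      using fun_cong [OF eq, of i] that by simp
    ultimately show "w = v" by (intro Wf_eqI)
  qed
qed

section \<open>An invariant form and the finite coroots\<close>

text \<open>An invariant integral form, obtained by summing a semidefinite one over the finite Weyl
  group. It is left unnormalized, so integrality costs nothing; the usual scaling is recovered by
  comparing with \<open>B th th\<close>.\<close>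

definition B :: "'p \<Rightarrow> 'p \<Rightarrow> int"
  where "B x y = (\<Sum>w\<in>Wf. \<Sum>i\<in>I. ac i (w x) * ac i (w y))"

lemma B_sym: "B x y = B y x"
  by (simp add: B_def mult.commute)

lemma B_additive: "additive (B x)"
  by (simp add: additive_def B_def additive.add [OF Wf_additive] distrib_left sum.distrib)

lemma B_additive': "additive (\<lambda>x. B x y)"
  using B_additive [of y] by (simp add: additive_def B_sym [of _ y])

lemmas B_simps =
  additive.add [OF B_additive] additive.add [OF B_additive']
  additive.diff [OF B_additive] additive.diff [OF B_additive']
  additive.minus [OF B_additive] additive.minus [OF B_additive']
  additive.zero [OF B_additive] additive.zero [OF B_additive']
  additive_int_scale [OF B_additive, unfolded int_scale_int]
  additive_int_scale [OF B_additive', unfolded int_scale_int]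

lemma B_Wf:
  assumes v: "v \<in> Wf" shows "B (v x) (v y) = B x y"
proof -
  obtain v' where v': "v' \<in> Wf" "\<And>x. v' (v x) = x" "\<And>x. v (v' x) = x"
    using Wf_inverse [OF v] by blast
  have "bij_betw (\<lambda>w. w \<circ> v) Wf Wf"
    by (rule bij_betw_byWitness [where f' = "\<lambda>w. w \<circ> v'"])
      (use v v' in \<open>auto simp: fun_eq_iff intro: Wf_comp\<close>)
  from sum.reindex_bij_betw [OF this, of "\<lambda>w. \<Sum>i\<in>I. ac i (w x) * ac i (w y)"]
  show ?thesis by (simp add: B_def)
qed

lemma B_dl [simp]: "B dl y = 0" "B y dl = 0"
proof -
  show "B dl y = 0"
    unfolding B_def by (intro sum.neutral ballI) (simp add: weyl_dl W_fin_def)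
  then show "B y dl = 0" by (simp add: B_sym)
qed

text \<open>Apply invariance under \<open>s i\<close>, which negates \<open>al i\<close>.\<close>

lemma B_al: "i \<in> I \<Longrightarrow> 2 * B (al i) y = B (al i) (al i) * ac i y"
  using B_Wf [OF Wf_s, of i "al i" y] by (simp add: srefl_def [of D i y] B_simps algebra_simps)

text \<open>The summand of the identity already suffices: if it vanishes, all simple coroots in
  \<open>I\<close> kill \<open>x\<close>, and \<open>A_nondeg\<close> gives
  \<open>x = 0\<close>.\<close>

lemma B_pos:
  assumes x: "x \<in> Q" "cf x z0 = 0" "x \<noteq> 0"
  shows "0 < B x x"
proof (rule ccontr)
  assume "\<not> 0 < B x x"
  moreover have "(\<Sum>i\<in>I. ac i (id x) * ac i (id x)) \<le> B x x"
    unfolding B_def using Wf_id finite_Wf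
    by (intro member_le_sum [of id Wf "\<lambda>w. \<Sum>i\<in>I. ac i (w x) * ac i (w x)"]) (auto intro: sum_nonneg)
  ultimately have "(\<Sum>i\<in>I. ac i x * ac i x) \<le> 0" by simp
  moreover have "0 \<le> (\<Sum>i\<in>I. ac i x * ac i x)" by (intro sum_nonneg) simp
  ultimately have "(\<Sum>i\<in>I. ac i x * ac i x) = 0" by simp
  then have "ac i x = 0" if "i \<in> I" for i
    using that by (subst (asm) sum_nonneg_eq_0_iff) auto
  then have "(\<Sum>j\<in>UNIV. A i j * cf x j) = 0" if "i \<in> I" for i
    using that x(1) ac_rl [of i "cf x"] by simp
  then have "cf x j = 0" for j using A_nondeg [of "cf x"] x(2) by blast
  then have "x = 0" using x(1) by (intro cf_eqI) auto
  then show False using x(3) by simp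
qed

lemma Phi_nonzero: "\<alpha> \<in> \<Phi> \<Longrightarrow> \<alpha> \<noteq> 0"
proof
  assume "\<alpha> \<in> \<Phi>" "\<alpha> = 0"
  then obtain w i where w: "w \<in> Wf" "w (al i) = 0" by (auto simp: fin_roots_def)
  then have "al i = 0"
    using Wf_inj [of w "al i" 0] additive.zero [OF Wf_additive [OF w(1)]] by simp
  then show False using cf_al [of i i] by simp
qed

lemma Phi_B_pos: "\<alpha> \<in> \<Phi> \<Longrightarrow> 0 < B \<alpha> \<alpha>"
  by (intro B_pos) (simp_all add: Phi_cf Phi_nonzero)

text \<open>\<open>ch \<alpha>\<close> is the coroot \<open>\<alpha>\<^sup>\<or>\<close>; the division is exact by \<open>ch_eq\<close> below.\<close>

definition ch :: "'p \<Rightarrow> 'p \<Rightarrow> int"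
  where "ch \<alpha> y = 2 * B \<alpha> y div B \<alpha> \<alpha>"

definition rf :: "'p \<Rightarrow> 'p \<Rightarrow> 'p"
  where "rf \<alpha> y = y - ch \<alpha> y \<cdot> \<alpha>"

lemma ch_al: "i \<in> I \<Longrightarrow> ch (al i) = ac i"
  using Phi_B_pos [OF Phi_al, of i] by (intro ext) (simp add: ch_def B_al)

lemma ch_Wf: "w \<in> Wf \<Longrightarrow> ch (w \<alpha>) (w y) = ch \<alpha> y"
  by (simp add: ch_def B_Wf)

lemma rf_Wf: "w \<in> Wf \<Longrightarrow> rf (w \<alpha>) (w y) = w (rf \<alpha> y)"
  by (simp add: rf_def ch_Wf Wf_diff Wf_scale)

lemma rf_al: "i \<in> I \<Longrightarrow> rf (al i) = s i"
  by (intro ext) (simp add: rf_def srefl_def ch_al)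

lemma ch_eq:
  assumes "\<alpha> \<in> \<Phi>" shows "B \<alpha> \<alpha> * ch \<alpha> y = 2 * B \<alpha> y"
proof -
  obtain w i where w: "w \<in> Wf" "i \<in> I" "\<alpha> = w (al i)" using assms by (auto simp: fin_roots_def)
  obtain v where v: "v \<in> Wf" "\<And>x. v (w x) = x" "\<And>x. w (v x) = x"
    using Wf_inverse [OF w(1)] by blast
  show ?thesis
    using B_al [OF w(2), of "v y"] ch_Wf [OF w(1), of "al i" "v y"] B_Wf [OF w(1), of "al i" "v y"]
      B_Wf [OF w(1), of "al i" "al i"] unfolding w(3) v(3) ch_al [OF w(2)] by simp
qed

lemma ch_unit:
  assumes "\<alpha> \<in> \<Phi>" obtains y where "ch \<alpha> y = 1"
proof -
  obtain w i where w: "w \<in> Wf" "i \<in> I" "\<alpha> = w (al i)" using assms by (auto simp: fin_roots_def)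
  then have "ch \<alpha> (w (\<Lambda> i)) = 1" by (simp add: ch_Wf ch_al ac_fweight)
  then show thesis using that by blast
qed

lemma rf_in_Wf:
  assumes "\<alpha> \<in> \<Phi>" shows "rf \<alpha> \<in> Wf"
proof -
  obtain w i where w: "w \<in> Wf" "i \<in> I" "\<alpha> = w (al i)" using assms by (auto simp: fin_roots_def)
  obtain v where v: "v \<in> Wf" "\<And>x. v (w x) = x" "\<And>x. w (v x) = x"
    using Wf_inverse [OF w(1)] by blast
  have "rf \<alpha> = w \<circ> (s i \<circ> v)"
    using rf_Wf [OF w(1), of "al i" "v _"] w v by (auto simp: rf_al fun_eq_iff)
  then show ?thesis using w v by (auto intro!: Wf_comp Wf_s)
qed

lemma ch_same [simp]: "\<alpha> \<in> \<Phi> \<Longrightarrow> ch \<alpha> \<alpha> = 2"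
  using Phi_B_pos [of \<alpha>] by (simp add: ch_def)

lemma ch_additive: "\<alpha> \<in> \<Phi> \<Longrightarrow> additive (ch \<alpha>)"
proof -
  assume \<alpha>: "\<alpha> \<in> \<Phi>"
  have "B \<alpha> \<alpha> * ch \<alpha> (x + y) = B \<alpha> \<alpha> * (ch \<alpha> x + ch \<alpha> y)" for x y
    by (simp add: ch_eq [OF \<alpha>] distrib_left B_simps)
  then show ?thesis using Phi_B_pos [OF \<alpha>] by (simp add: additive_def)
qed

lemma B_rl: "B (rl k) y = (\<Sum>j\<in>UNIV. k j * B (al j) y)"
  using additive.sum [OF B_additive' [of y], of "\<lambda>j. k j \<cdot> al j" UNIV]
  by (simp add: rl_def B_simps)

lemma B_rl_fin:
  assumes "k z0 = 0"
  shows "2 * B (rl k) y = (\<Sum>j\<in>UNIV. k j * B (al j) (al j) * ac j y)"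
proof -
  have *: "2 * (k j * B (al j) y) = k j * B (al j) (al j) * ac j y" for j
    using assms B_al [of j y] by (cases "j = z0") (auto simp: in_I)
  show ?thesis by (simp only: B_rl sum_distrib_left *)
qed

text \<open>The coefficient of the \<open>j\<close>-th simple coroot in the coroot of \<alpha> is
  its value at the fundamental weight. Its integrality supplies the divisibilities used for
  \<open>Phi_sign\<close>.\<close>

lemma ch_fweight:
  assumes "\<alpha> \<in> \<Phi>" shows "B \<alpha> \<alpha> * ch \<alpha> (\<Lambda> j) = cf \<alpha> j * B (al j) (al j)"
proof -
  have "2 * B (rl (cf \<alpha>)) (\<Lambda> j) = (\<Sum>l\<in>UNIV. cf \<alpha> l * B (al l) (al l) * ac l (\<Lambda> j))"
    using assms by (intro B_rl_fin Phi_cf)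
  also have "\<dots> = cf \<alpha> j * B (al j) (al j)"
    by (simp add: ac_fweight if_distrib [of "\<lambda>n. _ * n"] cong: if_cong)
  finally show ?thesis using assms by (simp add: ch_eq)
qed

text \<open>Adding \<open>k i \<cdot> al i\<close> to \<open>x\<close> changes the norm by
  \<open>k i * B (al i) (al i)\<close> times an integer, because \<open>2 * B (al i) x\<close> is
  \<open>B (al i) (al i) * ac i x\<close>.\<close>

lemma B_dvd:
  assumes "finite K" "K \<subseteq> I" "\<And>j. j \<in> I \<Longrightarrow> d dvd k j * B (al j) (al j)"
  shows "d dvd B (\<Sum>j\<in>K. k j \<cdot> al j) (\<Sum>j\<in>K. k j \<cdot> al j)"
  using assms(1,2)
proof (induction K rule: finite_induct)
  case empty
  then show ?case by (simp add: B_simps)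
next
  case (insert i K)
  let ?x = "\<Sum>j\<in>K. k j \<cdot> al j"
  have "B (\<Sum>j\<in>insert i K. k j \<cdot> al j) (\<Sum>j\<in>insert i K. k j \<cdot> al j) =
      B ?x ?x + k i * (2 * B (al i) ?x) + k i * (k i * B (al i) (al i))"
    using insert by (simp add: B_simps B_sym [of ?x "al i"] algebra_simps)
  also have "2 * B (al i) ?x = B (al i) (al i) * ac i ?x"
    using insert by (intro B_al) auto
  finally have eq: "B (\<Sum>j\<in>insert i K. k j \<cdot> al j) (\<Sum>j\<in>insert i K. k j \<cdot> al j) =
      B ?x ?x + (k i * B (al i) (al i)) * ac i ?x + k i * (k i * B (al i) (al i))"
    by (simp add: mult.assoc)
  have "d dvd k i * B (al i) (al i)" using insert assms(3) by blast
  moreover have "d dvd B ?x ?x" using insert by blast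
  ultimately show ?case unfolding eq by (intro dvd_add) auto
qed

lemma B_ge:
  assumes k: "k z0 = 0" "\<And>j. d dvd k j * B (al j) (al j)" "k i \<noteq> 0"
  shows "d \<le> B (rl k) (rl k)"
proof -
  have rl: "rl k = (\<Sum>j\<in>I. k j \<cdot> al j)"
    unfolding rl_def using k(1) by (intro sum.mono_neutral_right) (auto simp: in_I)
  have "d dvd B (rl k) (rl k)"
    unfolding rl using k by (intro B_dvd) auto
  moreover have "0 < B (rl k) (rl k)"
    using k rl_eq_0 [of k] by (intro B_pos) auto
  ultimately show ?thesis by (rule zdvd_imp_le)
qed

text \<open>
  A root \<open>\<alpha> = x - y\<close> with coefficients of both signs would split into nonzero \<open>x, y\<close> in the cone
  with \<open>B x y \<le> 0\<close>. Since \<open>\<alpha>\<^sup>\<or>\<close> is an integral combination of simple coroots, \<open>B x x\<close> and \<open>B y y\<close>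
  are multiples of \<open>B \<alpha> \<alpha>\<close>, so \<open>B \<alpha> \<alpha> \<ge> 2 B \<alpha> \<alpha>\<close>.
\<close>

lemma Phi_sign:
  assumes \<alpha>: "\<alpha> \<in> \<Phi>" shows "\<alpha> \<in> \<Phi>p \<or> - \<alpha> \<in> \<Phi>p"
proof (rule ccontr)
  assume "\<not> ?thesis"
  then have "\<not> (\<forall>i. 0 \<le> cf \<alpha> i)" "\<not> (\<forall>i. 0 \<le> - cf \<alpha> i)"
    using \<alpha> Phi_minus [OF \<alpha>] by (auto simp: pos_fin_roots_def root_cone_I Phi_cf cf_minus)
  then obtain p q where p: "cf \<alpha> p < 0" and q: "0 < cf \<alpha> q" by (auto simp: not_le)
  define k where "k = (\<lambda>j. max 0 (cf \<alpha> j))"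
  define l where "l = (\<lambda>j. max 0 (- cf \<alpha> j))"
  have kl: "k j - l j = cf \<alpha> j" "k j = 0 \<or> l j = 0" "0 \<le> k j" "0 \<le> l j" for j
    by (auto simp: k_def l_def)
  have z: "k z0 = 0" "l z0 = 0" using \<alpha> by (auto simp: k_def l_def Phi_cf)
  have dv: "B \<alpha> \<alpha> dvd cf \<alpha> j * B (al j) (al j)" for j
    using ch_fweight [OF \<alpha>, of j] by (metis dvd_triv_left)
  have dk: "B \<alpha> \<alpha> dvd k j * B (al j) (al j)" for j
    using dv [of j] by (auto simp: k_def max_def)
  have dl': "B \<alpha> \<alpha> dvd l j * B (al j) (al j)" for j
    using dv [of j] by (auto simp: l_def max_def)
  have k: "B \<alpha> \<alpha> \<le> B (rl k) (rl k)"
    by (rule B_ge [of k _ q]) (use z dk q in \<open>auto simp: k_def\<close>)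
  have l: "B \<alpha> \<alpha> \<le> B (rl l) (rl l)"
    by (rule B_ge [of l _ p]) (use z dl' p in \<open>auto simp: l_def\<close>)
  have "rl k - rl l = \<alpha>" using \<alpha> by (simp add: kl(1) flip: rl_diff)
  then have "B \<alpha> \<alpha> = B (rl k - rl l) (rl k - rl l)" by simp
  also have "\<dots> = B (rl k) (rl k) - 2 * B (rl k) (rl l) + B (rl l) (rl l)"
    by (simp add: B_simps B_sym [of "rl l" "rl k"])
  finally have eq: "B \<alpha> \<alpha> = B (rl k) (rl k) - 2 * B (rl k) (rl l) + B (rl l) (rl l)" .
  have "k j * B (al j) (al j) * ac j (rl l) \<le> 0" for j
  proof (cases "k j = 0 \<or> j = z0")
    case False
    then have j: "j \<in> I" "l j = 0" using kl(2) by (auto simp: in_I)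
    have "A j m * l m \<le> 0" for m
      using A_off [of j m] kl(4) [of m] j by (cases "j = m") (auto simp: mult_nonpos_nonneg)
    then have "ac j (rl l) \<le> 0" by (simp add: ac_rl sum_nonpos)
    then show ?thesis
      using kl(3) [of j] Phi_B_pos [OF Phi_al, of j] j by (simp add: mult_nonneg_nonpos)
  qed (use z in auto)
  then have "2 * B (rl k) (rl l) \<le> 0"
    by (simp add: B_rl_fin [of k, OF z(1)] sum_nonpos)
  then show False using eq k l Phi_B_pos [OF \<alpha>] by simp
qed

lemma Phi_pos: "\<alpha> \<in> \<Phi>p \<Longrightarrow> \<alpha> \<in> \<Phi>" "\<alpha> \<in> \<Phi>p \<Longrightarrow> 0 \<le> cf \<alpha> i"
  by (auto simp: pos_fin_roots_def root_cone_I)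

lemma Phi_posI: "\<alpha> \<in> \<Phi> \<Longrightarrow> 0 < cf \<alpha> j \<Longrightarrow> \<alpha> \<in> \<Phi>p"
  using Phi_sign [of \<alpha>] Phi_pos(2) [of "- \<alpha>" j] by (auto simp: cf_minus)

lemma Phi_not_pos: "\<alpha> \<in> \<Phi>p \<Longrightarrow> - \<alpha> \<notin> \<Phi>p"
proof
  assume \<alpha>: "\<alpha> \<in> \<Phi>p" "- \<alpha> \<in> \<Phi>p"
  then have "cf \<alpha> i = 0" for i
    using Phi_pos [of \<alpha>] Phi_pos [of "- \<alpha>"] by (simp add: cf_minus order_antisym)
  then have "\<alpha> = 0" using Phi_pos(1) [OF \<alpha>(1)] by (intro cf_eqI) auto
  then show False using Phi_nonzero [OF Phi_pos(1) [OF \<alpha>(1)]] by simp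
qed

lemma al_pos: "i \<in> I \<Longrightarrow> al i \<in> \<Phi>p"
  by (rule Phi_posI [of _ i]) (auto simp: Phi_al cf_al)

lemma th_pos: "th \<in> \<Phi>p"
  using th_Phi by (auto simp: pos_fin_roots_def root_cone_I cf_th less_imp_le [OF a_pos])

text \<open>The coroot of \<open>m \<cdot> \<beta>\<close> is the coroot of \<beta> divided by
  \<open>m\<close>. It must be integral at a weight where the coroot of \<beta> takes the value 1,
  so \<open>m\<close> is a unit.\<close>

lemma Phi_multiple:
  assumes \<alpha>: "\<alpha> \<in> \<Phi>" and \<beta>: "\<beta> \<in> \<Phi>" and eq: "\<alpha> = m \<cdot> \<beta>"
  shows "m = 1 \<or> m = -1"
proof -
  obtain y where y: "ch \<beta> y = 1" using ch_unit [OF \<beta>] by blast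
  have "B \<alpha> \<alpha> = m * m * B \<beta> \<beta>" by (simp add: eq B_simps)
  moreover have "B \<alpha> \<alpha> * ch \<alpha> y = m * B \<beta> \<beta>"
    using ch_eq [OF \<alpha>, of y] ch_eq [OF \<beta>, of y] y by (simp add: eq B_simps)
  ultimately have "B \<beta> \<beta> * (m * (m * ch \<alpha> y)) = B \<beta> \<beta> * (m * 1)" by (simp add: algebra_simps)
  moreover have "m \<noteq> 0" using Phi_nonzero [OF \<alpha>] by (auto simp: eq)
  ultimately have "m * ch \<alpha> y = 1" using Phi_B_pos [OF \<beta>] by simp
  then show ?thesis by (simp add: zmult_eq_1_iff) blast
qed

text \<open>A positive coefficient away from \<open>i\<close> survives \<open>s i\<close>, and
  \<open>Phi_sign\<close> turns it into positivity. Without such a coefficient \<alpha> is a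
  multiple of \<open>al i\<close>, hence equal to it.\<close>

lemma s_pos:
  assumes i: "i \<in> I" and \<alpha>: "\<alpha> \<in> \<Phi>p" "\<alpha> \<noteq> al i"
  shows "s i \<alpha> \<in> \<Phi>p"
proof (cases "\<exists>j. j \<noteq> i \<and> 0 < cf \<alpha> j")
  case True
  then obtain j where "j \<noteq> i" "0 < cf \<alpha> j" by blast
  then show ?thesis
    using Phi_pos(1) [OF \<alpha>(1)] i by (intro Phi_posI [of _ j]) (auto simp: Phi_s cf_s)
next
  case False
  then have "cf \<alpha> j = 0" if "j \<noteq> i" for j
    using Phi_pos(2) [OF \<alpha>(1), of j] that by force
  then have eq: "\<alpha> = cf \<alpha> i \<cdot> al i"
    using Phi_pos(1) [OF \<alpha>(1)] by (intro cf_eqI) (auto simp: cf_scale cf_al)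
  then have "cf \<alpha> i = 1"
    using Phi_multiple [OF Phi_pos(1) [OF \<alpha>(1)] Phi_al [OF i] eq] Phi_pos(2) [OF \<alpha>(1), of i] by auto
  then show ?thesis using eq \<alpha>(2) by (simp add: int_scale_one)
qed

section \<open>Word length and inversions\<close>

lemma refl_word_Wf: "is \<in> lists I \<Longrightarrow> refl_word D is \<in> Wf"
  by (simp add: W_fin_def weyl_gen_def)

text \<open>The exchange condition. If the first letter \<open>i\<close> is the one that turns the
  image of \<open>al j\<close> negative, that image was \<open>al i\<close>, so
  \<open>w \<circ> s j = s i \<circ> w\<close> and the letter cancels; otherwise a letter of the
  tail is deleted.\<close>

lemma exchange:
  assumes "is \<in> lists I" "j \<in> I" "- refl_word D is (al j) \<in> \<Phi>p"
  shows "\<exists>js\<in>lists I. length is = Suc (length js) \<and> refl_word D is \<circ> s j = refl_word D js"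
  using assms(1,3)
proof (induction "is")
  case Nil
  then show ?case using Phi_not_pos [OF al_pos [OF assms(2)]] by simp
next
  case (Cons i "is")
  define w where "w = refl_word D is"
  have w: "w \<in> Wf" and i: "i \<in> I" using Cons by (auto simp: w_def refl_word_Wf)
  have wj: "w (al j) \<in> \<Phi>" by (rule Phi_Wf [OF w Phi_al [OF assms(2)]])
  show ?case
  proof (cases "w (al j) \<in> \<Phi>p")
    case False
    then have "- w (al j) \<in> \<Phi>p" using Phi_sign [OF wj] by blast
    then have "\<exists>js\<in>lists I. length is = Suc (length js) \<and> w \<circ> s j = refl_word D js"
      unfolding w_def using Cons by (intro Cons.IH) auto
    then obtain js where "js \<in> lists I" "length is = Suc (length js)" "w \<circ> s j = refl_word D js"
      by blast
    then show ?thesis using i by (intro bexI [of _ "i # js"]) (auto simp: w_def fun_eq_iff)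
  next
    case True
    have "w (al j) = al i"
    proof (rule ccontr)
      assume "w (al j) \<noteq> al i"
      then have "s i (w (al j)) \<in> \<Phi>p" using s_pos i True by blast
      from Phi_not_pos [OF this] show False using Cons.prems by (simp add: w_def)
    qed
    then have "w (s j x) = s i (w x)" for x
      using rf_Wf [OF w, of "al j" x] i assms(2) by (simp add: rf_al)
    then have "refl_word D (i # is) \<circ> s j = refl_word D is"
      by (auto simp: fun_eq_iff simp flip: w_def)
    then show ?thesis using Cons.hyps by (intro bexI [of _ "is"]) (simp_all only: length_Cons simp_thms)
  qed
qed

definition ng :: "'p \<Rightarrow> int"
  where "ng \<alpha> = (if - \<alpha> \<in> \<Phi>p then 1 else 0)"

lemma finite_pos [simp]: "finite \<Phi>p"
  by (rule finite_subset [OF _ finite_Phi]) (auto simp: pos_fin_roots_def)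

lemma s_bij_pos: "i \<in> I \<Longrightarrow> bij_betw (s i) (\<Phi>p - {al i}) (\<Phi>p - {al i})"
proof (rule bij_betw_byWitness [where f' = "s i"])
  assume i: "i \<in> I"
  have "s i \<alpha> \<noteq> al i" if "\<alpha> \<in> \<Phi>p" for \<alpha>
  proof
    assume "s i \<alpha> = al i"
    then have "\<alpha> = - al i" using s_s [of i \<alpha>] by simp
    then show False using that Phi_not_pos [OF al_pos [OF i]] by simp
  qed
  then show "s i ` (\<Phi>p - {al i}) \<subseteq> \<Phi>p - {al i}" using s_pos [OF i] by auto
  then show "s i ` (\<Phi>p - {al i}) \<subseteq> \<Phi>p - {al i}" .
qed auto

lemma inversions_step:
  assumes j: "j \<in> I" and v: "v \<in> Wf" and pos: "v (al j) \<in> \<Phi>p"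
  shows "(\<Sum>\<alpha>\<in>\<Phi>p. ng (v (s j \<alpha>))) = (\<Sum>\<alpha>\<in>\<Phi>p. ng (v \<alpha>)) + 1"
proof -
  have split: "(\<Sum>\<alpha>\<in>\<Phi>p. f \<alpha>) = f (al j) + (\<Sum>\<alpha>\<in>\<Phi>p - {al j}. f \<alpha>)" for f :: "'p \<Rightarrow> int"
    by (rule sum.remove) (auto simp: al_pos j)
  have "(\<Sum>\<alpha>\<in>\<Phi>p - {al j}. ng (v (s j \<alpha>))) = (\<Sum>\<alpha>\<in>\<Phi>p - {al j}. ng (v \<alpha>))"
    by (rule sum.reindex_bij_betw [OF s_bij_pos [OF j], of "\<lambda>\<alpha>. ng (v \<alpha>)"])
  moreover have "ng (v (s j (al j))) = 1" "ng (v (al j)) = 0"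
    using v pos Phi_not_pos [OF pos] by (auto simp: ng_def Wf_minus)
  ultimately show ?thesis by (simp add: split)
qed

lemma inversions_word:
  assumes "is \<in> lists I"
    and "\<And>js. js \<in> lists I \<Longrightarrow> refl_word D js = refl_word D is \<Longrightarrow> length is \<le> length js"
  shows "(\<Sum>\<alpha>\<in>\<Phi>p. ng (refl_word D is \<alpha>)) = int (length is)"
  using assms
proof (induction "is" rule: rev_induct)
  case Nil
  have "ng \<alpha> = 0" if "\<alpha> \<in> \<Phi>p" for \<alpha> using Phi_not_pos [OF that] by (simp add: ng_def)
  then show ?case by simp
next
  case (snoc j "is")
  have j: "j \<in> I" and is_I: "is \<in> lists I" using snoc(2) by auto
  define v where "v = refl_word D is"
  have v: "v \<in> Wf" using is_I by (simp add: v_def refl_word_Wf)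
  have vj: "refl_word D (is @ [j]) = v \<circ> s j" by (auto simp: refl_word_append v_def)
  have "length is \<le> length js" if "js \<in> lists I" "refl_word D js = v" for js
  proof -
    have "length (is @ [j]) \<le> length (js @ [j])"
      using that j by (intro snoc(3)) (auto simp: refl_word_append v_def)
    then show ?thesis by simp
  qed
  then have IH: "(\<Sum>\<alpha>\<in>\<Phi>p. ng (v \<alpha>)) = int (length is)"
    using snoc(1) is_I by (simp add: v_def)
  \<comment> \<open>Otherwise \<open>exchange\<close> would write \<open>v \<circ> s j\<close> with
    fewer letters than the minimal word \<open>is @ [j]\<close>; hence the last letter creates one
    new inversion.\<close>
  have "v (al j) \<in> \<Phi>p"
  proof (rule ccontr)
    assume "v (al j) \<notin> \<Phi>p"
    then have "- v (al j) \<in> \<Phi>p" using Phi_sign [OF Phi_Wf [OF v Phi_al [OF j]]] by blast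
    then obtain js where "js \<in> lists I" "length is = Suc (length js)" "v \<circ> s j = refl_word D js"
      using exchange [OF is_I j] by (auto simp: v_def)
    then show False using snoc(3) [of js] vj by simp
  qed
  from inversions_step [OF j v this] show ?case using IH by (simp add: vj)
qed

lemma weyl_length_inversions:
  assumes "v \<in> Wf"
  shows "int (weyl_length D v) = (\<Sum>\<alpha>\<in>\<Phi>p. ng (v \<alpha>))"
proof -
  let ?P = "\<lambda>n. \<exists>is\<in>lists I. length is = n \<and> refl_word D is = v"
  have "?P (weyl_length D v)"
    unfolding weyl_length_def
    by (rule LeastI_ex) (use assms in \<open>auto simp: W_fin_def weyl_gen_def\<close>)
  then obtain "is" where "is": "is \<in> lists I" "length is = weyl_length D v" "refl_word D is = v"
    by blast
  have "length is \<le> length js" if "js \<in> lists I" "refl_word D js = refl_word D is" for js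
    unfolding "is"(2) weyl_length_def by (rule Least_le) (use that "is" in auto)
  then show ?thesis using inversions_word [OF "is"(1)] "is" by simp
qed

subsection \<open>Translations\<close>

abbreviation "Wa \<equiv> W_af D"

lemmas Wa_id = weyl_gen_id [of D UNIV, folded W_af_def]
  and Wa_s = weyl_gen_srefl [of _ UNIV D, folded W_af_def, OF UNIV_I]
  and Wa_comp = weyl_gen_comp [of _ D UNIV, folded W_af_def]
  and Wa_induct = weyl_gen_induct [of _ D UNIV, folded W_af_def, simplified, consumes 1, case_names id srefl]
  and Wa_additive = weyl_additive [of _ UNIV, folded W_af_def]
  and Wa_inverse = weyl_inverse [of _ UNIV, folded W_af_def]
  and Wa_inj = weyl_inj [of _ UNIV, folded W_af_def]
  and Wa_Q = weyl_Q [of _ UNIV, folded W_af_def]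
  and Wa_dl [simp] = weyl_dl [of _ UNIV, folded W_af_def]
  and Wf_dl [simp] = weyl_dl [of _ I, folded W_fin_def]

lemmas Wa_add = additive.add [OF Wa_additive]
  and Wa_minus = additive.minus [OF Wa_additive]
  and Wa_diff = additive.diff [OF Wa_additive]
  and Wa_scale = additive_int_scale [OF Wa_additive]

abbreviation "c \<equiv> central D"

lemma c_additive: "additive c"
  by (simp add: additive_def central_def distrib_left sum.distrib)

lemmas c_add [simp] = additive.add [OF c_additive]
  and c_diff [simp] = additive.diff [OF c_additive]
  and c_minus [simp] = additive.minus [OF c_additive]
  and c_scale [simp] = additive_int_scale [OF c_additive, unfolded int_scale_int]

lemma c_al [simp]: "c (al j) = 0"
  by (simp add: central_def ac_al av_A)

lemma c_Q: "x \<in> Q \<Longrightarrow> c x = 0"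
  using additive.sum [OF c_additive, of "\<lambda>j. cf x j \<cdot> al j" UNIV]
  by (simp flip: rl_def)

lemma c_Wa [simp]: "w \<in> Wa \<Longrightarrow> c (w x) = c x"
  by (induction arbitrary: x rule: Wa_induct) (auto simp: srefl_def)

section \<open>The highest root and the affine simple coroot\<close>

lemma B_th_pos: "0 < B th th"
  by (rule Phi_B_pos [OF th_Phi])

text \<open>If the pairing were at least 2, the root \<open>- rf th \<alpha>\<close>, which is a
  multiple of \<theta> minus \<alpha>, could lie below \<theta> only if \<theta> lies below
  \<alpha>.\<close>

lemma ch_th_le: assumes "\<alpha> \<in> \<Phi>" "\<alpha> \<noteq> th" shows "ch th \<alpha> \<le> 1"
proof (rule ccontr)
  assume "\<not> ch th \<alpha> \<le> 1"
  then have k: "1 \<le> ch th \<alpha> - 1" by simp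
  have "- rf th \<alpha> \<in> \<Phi>" using Phi_minus [OF Phi_Wf [OF rf_in_Wf [OF th_Phi] assms(1)]] .
  then have 1: "ch th \<alpha> * cf th i - cf \<alpha> i \<le> cf th i" for i
    using Phi_le_th [of "- rf th \<alpha>" i] assms(1) by (simp add: rf_def cf_minus cf_diff cf_scale)
  have 2: "cf th i \<le> ch th \<alpha> * cf th i - cf th i" for i
    using mult_right_mono [OF k Phi_pos(2) [OF th_pos, of i]] by (simp add: left_diff_distrib)
  have "cf th i \<le> cf \<alpha> i" for i
    using 1 [of i] 2 [of i] by linarith
  then have "cf \<alpha> i = cf th i" for i using Phi_le_th [OF assms(1), of i] by (simp add: order_antisym)
  then have "\<alpha> = th" using assms(1) by (intro cf_eqI) auto
  then show False using assms(2) by simp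
qed

lemma ch_minus: "\<alpha> \<in> \<Phi> \<Longrightarrow> ch \<alpha> (- y) = - ch \<alpha> y"
  by (rule additive.minus [OF ch_additive])

lemma ch_th_ge: "\<alpha> \<in> \<Phi> \<Longrightarrow> \<alpha> \<noteq> - th \<Longrightarrow> - 1 \<le> ch th \<alpha>"
  using ch_th_le [OF Phi_minus, of \<alpha>] minus_minus [of \<alpha>]
  by (cases "- \<alpha> = th") (simp_all add: ch_minus th_Phi)

lemma ac_th: "ac j th = - A j z0"
  by (simp add: th_def ac_al)

lemma B_al_th: "j \<in> I \<Longrightarrow> B th th * ch th (al j) = - B (al j) (al j) * A j z0"
  using B_al [of j th] by (simp add: ch_eq th_Phi B_sym [of th "al j"] ac_th)

lemma ch_th_al_zero: assumes "j \<in> I" shows "ch th (al j) = 0 \<longleftrightarrow> A z0 j = 0"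
proof -
  have "ch th (al j) = 0 \<longleftrightarrow> A j z0 = 0"
    using B_al_th [OF assms] B_th_pos Phi_B_pos [OF Phi_al [OF assms]] by auto
  then show ?thesis using A_zero by blast
qed

lemma ch_rl: "\<alpha> \<in> \<Phi> \<Longrightarrow> ch \<alpha> (rl k) = (\<Sum>j\<in>UNIV. k j * ch \<alpha> (al j))"
  using additive.sum [OF ch_additive, of \<alpha> "\<lambda>j. k j \<cdot> al j" UNIV]
  by (simp add: rl_def additive_int_scale [OF ch_additive])

lemma sum_UNIV_I: "sum f UNIV = f z0 + sum f I" for f :: "'i \<Rightarrow> int"
  by (simp add: UNIV_split)

text \<open>Weighted by the marks, \<open>- A z0 j\<close> and \<open>ch th (al j)\<close> both sum
  to 2 over \<open>I\<close>. Outside rank one the first dominates the second termwise, because they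
  vanish together and the second is at most 1; so they agree termwise.\<close>

lemma A_z0: assumes j: "j \<in> I" shows "A z0 j = - ch th (al j)"
proof -
  have "ch th (rl (cf th)) = 2" by (simp add: th_Phi)
  then have "(\<Sum>j\<in>I. a j * ch th (al j)) = 2"
    unfolding ch_rl [OF th_Phi] sum_UNIV_I
    by (simp add: cf_th in_I cong: sum.cong_simp)
  moreover have "(\<Sum>j\<in>I. a j * A z0 j) = - 2"
    using A_a [of z0] by (simp add: sum_UNIV_I mult.commute)
  ultimately have sum0: "(\<Sum>j\<in>I. a j * (- A z0 j - ch th (al j))) = 0"
    by (simp add: right_diff_distrib sum_subtractf sum_negf)
  have "- A z0 j - ch th (al j) = 0"
  proof (cases "\<exists>l\<in>I. th = al l")
    \<comment> \<open>If \<theta> is simple, positivity of the marks leaves a single node in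
      \<open>I\<close>, and the sum itself gives the claim.\<close>
    case True
    then obtain l where l: "l \<in> I" "th = al l" by blast
    have "i = l" if "i \<in> I" for i
      using cf_th [of i] that a_pos [of i] by (auto simp: in_I l cf_al split: if_splits)
    then have "I = {j}" using j l(1) by blast
    then show ?thesis using sum0 a_pos [of j] by simp
  next
    case False
    have "0 \<le> - A z0 l - ch th (al l)" if l: "l \<in> I" for l
    proof -
      have "ch th (al l) \<le> 1" using ch_th_le [OF Phi_al [OF l]] False l by metis
      moreover have "A z0 l \<le> 0" using A_off [of z0 l] l by (auto simp: in_I)
      ultimately show ?thesis using ch_th_al_zero [OF l] by (cases "A z0 l = 0") auto
    qed
    then have "\<forall>l\<in>I. a l * (- A z0 l - ch th (al l)) = 0"
      using sum0 sum_nonneg_eq_0_iff [of I "\<lambda>l. a l * (- A z0 l - ch th (al l))"] a_pos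
      by (simp add: less_imp_le)
    then show ?thesis using j a_pos [of j] by auto
  qed
  then show ?thesis by simp
qed

lemma ch_expand: assumes "\<alpha> \<in> \<Phi>" shows "ch \<alpha> y = (\<Sum>j\<in>UNIV. ch \<alpha> (\<Lambda> j) * ac j y)"
proof -
  have "B \<alpha> \<alpha> * ch \<alpha> y = 2 * B (rl (cf \<alpha>)) y" using assms by (simp add: ch_eq)
  also have "\<dots> = (\<Sum>j\<in>UNIV. cf \<alpha> j * B (al j) (al j) * ac j y)"
    by (rule B_rl_fin) (simp add: Phi_cf assms)
  also have "\<dots> = B \<alpha> \<alpha> * (\<Sum>j\<in>UNIV. ch \<alpha> (\<Lambda> j) * ac j y)"
    by (simp add: sum_distrib_left ch_fweight [OF assms, symmetric] mult.assoc)
  finally show ?thesis using Phi_B_pos [OF assms] by simp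
qed

lemma ch_fweight_z0: "\<alpha> \<in> \<Phi> \<Longrightarrow> ch \<alpha> (\<Lambda> z0) = 0"
  using ch_fweight [of \<alpha> z0] Phi_B_pos [of \<alpha>] by (simp add: Phi_cf)

text \<open>The coroot of \<theta> has the comarks as coefficients: both vectors pair with each
  \<open>al j\<close>, \<open>j \<in> I\<close>, to \<open>- A z0 j\<close>, and
  \<open>A_nondeg_transpose\<close> separates vectors that vanish at \<open>z0\<close>.\<close>

lemma ch_th_fweight: assumes "i \<in> I" shows "ch th (\<Lambda> i) = av i"
proof -
  define k where "k = (\<lambda>i. ch th (\<Lambda> i) - (if i = z0 then 0 else av i))"
  have "(\<Sum>i\<in>UNIV. k i * A i j) = 0" if j: "j \<in> I" for j
  proof -
    have "(\<Sum>i\<in>UNIV. ch th (\<Lambda> i) * A i j) = ch th (al j)"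
      using ch_expand [OF th_Phi, of "al j"] by (simp add: ac_al)
    moreover have "(\<Sum>i\<in>UNIV. (if i = z0 then 0 else av i) * A i j) = - A z0 j"
      using av_A [of j] by (simp add: sum_UNIV_I in_I cong: sum.cong_simp)
    ultimately show ?thesis using A_z0 [OF j] by (simp add: k_def left_diff_distrib sum_subtractf)
  qed
  then have "k i = 0"
    using A_nondeg_transpose [of k i] by (simp add: k_def ch_fweight_z0 th_Phi)
  then show ?thesis using assms by (simp add: k_def in_I split: if_splits)
qed

text \<open>The zeroth simple coroot is \<open>c\<close> minus the coroot of \<theta>, as
  functionals on the whole weight lattice. This expresses \<open>s z0\<close> through the finite
  reflection in \<theta>.\<close>

lemma ac_z0: "ac z0 y = c y - ch th y"
proof -
  have "ch th y = (\<Sum>j\<in>I. av j * ac j y)"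
    by (subst ch_expand [OF th_Phi])
      (simp add: sum_UNIV_I ch_fweight_z0 th_Phi ch_th_fweight cong: sum.cong_simp)
  then show ?thesis by (simp add: central_def sum_UNIV_I)
qed

text \<open>Let \<open>K\<close> collect the nodes whose orbit is orthogonal to \<theta>.
  Connectedness gives an edge from \<open>k\<close> in \<open>K\<close> to some \<open>j\<close>
  outside. An edge to \<open>z0\<close> makes \<open>al k\<close> itself nonorthogonal; otherwise
  applying \<open>w \<circ> s j\<close> to \<open>al k\<close> brings in a multiple of
  \<open>w (al j)\<close>.\<close>

lemma th_orbit_nonorthogonal:
  assumes i: "i \<in> I" shows "\<exists>w\<in>Wf. ch th (w (al i)) \<noteq> 0"
proof (rule ccontr)
  assume no: "\<not> ?thesis"
  define K where "K = {i\<in>I. \<forall>w\<in>Wf. ch th (w (al i)) = 0}"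
  have "i \<in> K" "z0 \<notin> K" using i no by (auto simp: K_def)
  then have "K \<noteq> {}" "K \<noteq> UNIV" by auto
  then obtain k j where k: "k \<in> K" and j: "j \<notin> K" and A: "A k j \<noteq> 0" using A_conn by blast
  have kI: "k \<in> I" using k by (simp add: K_def)
  show False
  proof (cases "j = z0")
    case True
    have "ch th (id (al k)) = 0" using k Wf_id unfolding K_def by blast
    then show False using ch_th_al_zero [OF kI] A_zero [of z0 k] A True by simp
  next
    case False
    then obtain w where w: "w \<in> Wf" "ch th (w (al j)) \<noteq> 0" using j by (auto simp: K_def in_I)
    have "w \<circ> s j \<in> Wf" using w False by (intro Wf_comp Wf_s) (auto simp: in_I)
    then have "ch th ((w \<circ> s j) (al k)) = 0" using k unfolding K_def by blast
    moreover have "ch th (w (al k)) = 0" using k w unfolding K_def by blast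
    ultimately have "A j k * ch th (w (al j)) = 0"
      using w(1) by (simp add: srefl_def Wf_diff Wf_scale ac_al additive.diff [OF ch_additive]
          additive_int_scale [OF ch_additive] th_Phi)
    then show False using w(2) A_zero [of j k] A by simp
  qed
qed

text \<open>Some conjugate of \<open>al i\<close> is \<theta> or -\<theta>, or pairs to 1 or -1 with
  the coroot of \<theta>; comparing the two coroot formulas gives the quotient.\<close>

lemma B_al_dvd: assumes i: "i \<in> I" shows "B (al i) (al i) dvd B th th"
proof -
  obtain w where w: "w \<in> Wf" "ch th (w (al i)) \<noteq> 0" using th_orbit_nonorthogonal [OF i] by blast
  have \<alpha>: "w (al i) \<in> \<Phi>" by (rule Phi_Wf [OF w(1) Phi_al [OF i]])
  have B: "B (w (al i)) (w (al i)) = B (al i) (al i)" by (rule B_Wf [OF w(1)])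
  show ?thesis
  proof (cases "w (al i) = th \<or> w (al i) = - th")
    case True
    then have "B th th = B (al i) (al i)" using B by (auto simp: B_simps)
    then show ?thesis by simp
  next
    case False
    then have "ch th (w (al i)) = 1 \<or> ch th (w (al i)) = - 1"
      using ch_th_le [OF \<alpha>] ch_th_ge [OF \<alpha>] w(2) by auto
    moreover have "B th th * ch th (w (al i)) = B (al i) (al i) * ch (w (al i)) th"
      using ch_eq [OF th_Phi, of "w (al i)"] ch_eq [OF \<alpha>, of th] B
      by (simp add: B_sym [of th "w (al i)"])
    ultimately have "B th th = B (al i) (al i) * ch (w (al i)) th \<or>
        B th th = B (al i) (al i) * - ch (w (al i)) th" by auto
    then show ?thesis by (metis dvd_triv_left)
  qed
qed

text \<open>Here the division in \<open>nu\<close> is seen to be exact: \<open>ch_fweight\<close>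
  relates marks to comarks, and \<open>B_al_dvd\<close> makes the ratio an integer.\<close>

lemma mark_div:
  assumes i: "i \<in> I" shows "a i div av i * B (al i) (al i) = B th th"
proof -
  obtain e where e: "B th th = B (al i) (al i) * e" using B_al_dvd [OF i] by blast
  have "B th th * av i = a i * B (al i) (al i)"
    using ch_fweight [OF th_Phi, of i] i by (simp add: ch_th_fweight cf_th in_I)
  then have "B (al i) (al i) * (av i * e) = B (al i) (al i) * a i" by (simp add: e mult_ac)
  then have "a i = av i * e" using Phi_B_pos [OF Phi_al [OF i]] by simp
  then show ?thesis using av_pos [of i] by (simp add: e mult.commute)
qed

section \<open>The coroot lattice, \<open>nu\<close> and translations\<close>

lemma Q_check_cases:
  assumes "\<xi> \<in> Q_check D"
  obtains k where "\<xi> = (\<lambda>\<mu>. \<Sum>i\<in>I. k i * ac i \<mu>)" "\<And>i. i \<in> I \<Longrightarrow> \<xi> (\<Lambda> i) = k i"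
proof -
  obtain k where k: "\<xi> = (\<lambda>\<mu>. \<Sum>i\<in>I. k i * ac i \<mu>)" using assms by (auto simp: Q_check_def)
  have "\<xi> (\<Lambda> i) = k i" if "i \<in> I" for i
    using that by (simp add: k ac_fweight if_distrib [of "\<lambda>n. _ * n"] cong: if_cong)
  then show thesis using that k by blast
qed

lemma Q_check_additive: "\<xi> \<in> Q_check D \<Longrightarrow> additive \<xi>"
  by (auto simp: Q_check_def additive_def distrib_left sum.distrib)

lemma Q_check_dl [simp]: "\<xi> \<in> Q_check D \<Longrightarrow> \<xi> dl = 0"
  by (auto simp: Q_check_def)

lemma Q_check_diff: "\<xi> \<in> Q_check D \<Longrightarrow> \<eta> \<in> Q_check D \<Longrightarrow> (\<lambda>\<mu>. \<xi> \<mu> - \<eta> \<mu>) \<in> Q_check D"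
  by (auto simp: Q_check_def simp flip: sum_subtractf left_diff_distrib)

lemma ch_Q_check: "\<alpha> \<in> \<Phi> \<Longrightarrow> ch \<alpha> \<in> Q_check D"
proof -
  assume \<alpha>: "\<alpha> \<in> \<Phi>"
  have "ch \<alpha> = (\<lambda>y. \<Sum>j\<in>I. ch \<alpha> (\<Lambda> j) * ac j y)"
    by (rule ext, subst ch_expand [OF \<alpha>]) (simp add: sum_UNIV_I ch_fweight_z0 \<alpha>)
  then show ?thesis unfolding Q_check_def by (intro CollectI exI conjI TrueI)
qed

lemma nu_rl: "nu D \<xi> = rl (\<lambda>i. if i = z0 then 0 else \<xi> (\<Lambda> i) * (a i div av i))"
  unfolding nu_def rl_def by (intro sum.mono_neutral_cong_left) (auto simp: in_I)

lemma nu_Q [simp]: "nu D \<xi> \<in> Q" and cf_nu: "cf (nu D \<xi>) z0 = 0"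
  by (simp_all add: nu_rl)

text \<open>\<open>nu D \<xi>\<close> represents \<xi> for the form rescaled so that \<theta> has
  norm 2; by \<open>mark_div\<close> the coefficients in \<open>nu\<close> are the right ratios of
  norms.\<close>

lemma B_nu:
  assumes "\<xi> \<in> Q_check D" shows "2 * B (nu D \<xi>) y = B th th * \<xi> y"
proof -
  obtain k where k: "\<xi> = (\<lambda>\<mu>. \<Sum>i\<in>I. k i * ac i \<mu>)" "\<And>i. i \<in> I \<Longrightarrow> \<xi> (\<Lambda> i) = k i"
    by (rule Q_check_cases [OF assms]) blast
  have "2 * B (nu D \<xi>) y =
      (\<Sum>j\<in>I. \<xi> (\<Lambda> j) * (a j div av j) * B (al j) (al j) * ac j y)"
    unfolding nu_rl by (subst B_rl_fin) (simp_all add: sum_UNIV_I in_I cong: sum.cong_simp)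
  also have "\<dots> = (\<Sum>j\<in>I. B th th * (k j * ac j y))"
    by (intro sum.cong refl) (simp add: k(2) mark_div [symmetric])
  finally show ?thesis by (simp add: k(1) sum_distrib_left)
qed

lemma nu_eqI:
  assumes \<xi>: "\<xi> \<in> Q_check D" and x: "x \<in> Q" "cf x z0 = 0" "\<And>y. 2 * B x y = B th th * \<xi> y"
  shows "nu D \<xi> = x"
proof (rule ccontr)
  assume "nu D \<xi> \<noteq> x"
  then have "0 < B (nu D \<xi> - x) (nu D \<xi> - x)"
    using x by (intro B_pos) (simp_all add: cf_diff cf_nu)
  moreover have "2 * B (nu D \<xi> - x) y = 0" for y
    using B_nu [OF \<xi>, of y] x(3) [of y] by (simp add: B_simps)
  ultimately show False by (metis less_irrefl mult_eq_0_iff zero_neq_numeral)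
qed

lemma nu_ch: "\<kappa> \<in> \<Phi> \<Longrightarrow> B \<kappa> \<kappa> = B th th \<Longrightarrow> nu D (ch \<kappa>) = \<kappa>"
  using ch_eq [of \<kappa>] by (intro nu_eqI ch_Q_check) (simp_all add: Phi_cf)

lemma nu_diff:
  "\<xi> \<in> Q_check D \<Longrightarrow> \<eta> \<in> Q_check D \<Longrightarrow> nu D (\<lambda>\<mu>. \<xi> \<mu> - \<eta> \<mu>) = nu D \<xi> - nu D \<eta>"
  by (intro nu_eqI Q_check_diff)
    (simp_all add: cf_diff cf_nu B_simps B_nu right_diff_distrib)

lemma nu_sym:
  assumes "\<xi> \<in> Q_check D" "\<eta> \<in> Q_check D" shows "\<xi> (nu D \<eta>) = \<eta> (nu D \<xi>)"
proof -
  have "B th th * \<xi> (nu D \<eta>) = B th th * \<eta> (nu D \<xi>)"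
    using B_nu [OF assms(1), of "nu D \<eta>"] B_nu [OF assms(2), of "nu D \<xi>"]
    by (simp add: B_sym [of "nu D \<eta>"])
  then show ?thesis using B_th_pos by simp
qed

lemma transl_level_zero: "c \<mu> = 0 \<Longrightarrow> transl D \<xi> \<mu> = \<mu> - \<xi> \<mu> \<cdot> dl"
  by (simp add: transl_def)

lemma c_transl [simp]: "c (transl D \<xi> \<mu>) = c \<mu>"
  by (simp add: transl_def c_Q)

text \<open>
  Subtracting \<open>\<kappa>\<^sup>\<or>\<close> from \<open>\<zeta>\<close> changes the norm by an even number, so no
  parity of the form is needed to handle the integer division in the definition of translations.
\<close>

lemma transl_diff_ch:
  assumes \<zeta>: "\<zeta> \<in> Q_check D" and \<kappa>: "\<kappa> \<in> \<Phi>" "B \<kappa> \<kappa> = B th th"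
  shows "transl D (\<lambda>\<mu>. \<zeta> \<mu> - ch \<kappa> \<mu>) \<mu> =
    transl D \<zeta> \<mu> - c \<mu> \<cdot> \<kappa> + (ch \<kappa> (transl D \<zeta> \<mu>) - c \<mu>) \<cdot> dl"
proof -
  note ch = ch_Q_check [OF \<kappa>(1)]
  have sym: "ch \<kappa> (nu D \<zeta>) = \<zeta> \<kappa>" using nu_sym [OF ch \<zeta>] by (simp add: nu_ch \<kappa>)
  define q where "q = \<zeta> (nu D \<zeta>)"
  have "\<zeta> (nu D \<zeta> - \<kappa>) - ch \<kappa> (nu D \<zeta> - \<kappa>) = q + 2 * (1 - \<zeta> \<kappa>)"
    by (simp add: q_def additive.diff [OF Q_check_additive [OF \<zeta>]]
        additive.diff [OF Q_check_additive [OF ch]] sym \<kappa>)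
  then have "(\<zeta> (nu D \<zeta> - \<kappa>) - ch \<kappa> (nu D \<zeta> - \<kappa>)) div 2 = q div 2 + (1 - \<zeta> \<kappa>)" by simp
  then have 1: "transl D (\<lambda>\<mu>. \<zeta> \<mu> - ch \<kappa> \<mu>) \<mu> =
      \<mu> + c \<mu> \<cdot> (nu D \<zeta> - \<kappa>) - (\<zeta> \<mu> - ch \<kappa> \<mu> + (q div 2 + (1 - \<zeta> \<kappa>)) * c \<mu>) \<cdot> dl"
    using nu_diff [OF \<zeta> ch] by (simp add: transl_def nu_ch \<kappa>)
  have 2: "transl D \<zeta> \<mu> = \<mu> + c \<mu> \<cdot> nu D \<zeta> - (\<zeta> \<mu> + q div 2 * c \<mu>) \<cdot> dl"
    by (simp add: transl_def q_def)
  have 3: "ch \<kappa> (transl D \<zeta> \<mu>) = ch \<kappa> \<mu> + c \<mu> * \<zeta> \<kappa>"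
    by (simp add: 2 additive.diff [OF ch_additive] additive.add [OF ch_additive]
        additive_int_scale [OF ch_additive] \<kappa> sym Q_check_dl [OF ch])
  show ?thesis unfolding 1 3 unfolding 2
    by (simp add: int_module.scale_right_diff_distrib int_module.scale_left_diff_distrib
        int_scale_add_left algebra_simps)
qed

text \<open>On the group side, \<open>s z0\<close> is the reflection in \<theta> after the
  translation by the negative coroot of \<theta>. Moving that translation past \<open>v\<close>
  replaces \<theta> by its preimage \<kappa> under \<open>v\<close>.\<close>

lemma s_z0_transl:
  assumes v: "v \<in> Wf" and \<zeta>: "\<zeta> \<in> Q_check D"
  shows "\<exists>v'\<in>Wf. \<exists>\<eta>\<in>Q_check D. s z0 \<circ> (v \<circ> transl D \<zeta>) = v' \<circ> transl D \<eta>"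
proof -
  obtain u where u: "u \<in> Wf" "\<And>x. u (v x) = x" "\<And>x. v (u x) = x"
    using Wf_inverse [OF v] by blast
  define \<kappa> where "\<kappa> = u th"
  have \<kappa>: "\<kappa> \<in> \<Phi>" "B \<kappa> \<kappa> = B th th" "v \<kappa> = th"
    using u by (simp_all add: \<kappa>_def Phi_Wf th_Phi B_Wf)
  have "s z0 (v (transl D \<zeta> \<mu>)) = rf th (v (transl D (\<lambda>\<mu>. \<zeta> \<mu> - ch \<kappa> \<mu>) \<mu>))" for \<mu>
  proof -
    define y where "y = v (transl D \<zeta> \<mu>)"
    have vW: "v \<in> Wa" using v W_fin_sub by blast
    have cy: "c y = c \<mu>" using vW by (simp add: y_def)
    have g: "ch \<kappa> (transl D \<zeta> \<mu>) = ch th y"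
      using ch_Wf [OF v, of \<kappa> "transl D \<zeta> \<mu>"] by (simp add: y_def \<kappa>)
    have "v (transl D (\<lambda>\<mu>. \<zeta> \<mu> - ch \<kappa> \<mu>) \<mu>) = y - c \<mu> \<cdot> th + (ch th y - c \<mu>) \<cdot> dl"
      by (simp add: transl_diff_ch [OF \<zeta> \<kappa>(1,2)] Wa_add [OF vW] Wa_diff [OF vW]
          Wa_scale [OF vW] \<kappa> g Wa_dl [OF vW] flip: y_def)
    moreover have "ch th (y - c \<mu> \<cdot> th + (ch th y - c \<mu>) \<cdot> dl) = ch th y - 2 * c \<mu>"
      by (simp add: additive.diff [OF ch_additive] additive.add [OF ch_additive]
        additive_int_scale [OF ch_additive] th_Phi Q_check_dl [OF ch_Q_check])
    moreover have "s z0 y = y - (c \<mu> - ch th y) \<cdot> (dl - th)"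
      by (simp add: srefl_def ac_z0 cy th_def)
    moreover have "(ch th y - 2 * c \<mu>) \<cdot> th = ch th y \<cdot> th - c \<mu> \<cdot> th - c \<mu> \<cdot> th"
      by (simp flip: int_module.scale_left_diff_distrib)
    ultimately show ?thesis
      unfolding y_def [symmetric] rf_def
      by (simp only: int_module.scale_right_diff_distrib int_module.scale_left_diff_distrib)
        (simp add: algebra_simps)
  qed
  then have "s z0 \<circ> (v \<circ> transl D \<zeta>) = (rf th \<circ> v) \<circ> transl D (\<lambda>\<mu>. \<zeta> \<mu> - ch \<kappa> \<mu>)"
    by (auto simp: fun_eq_iff)
  then show ?thesis
    using Wf_comp [OF rf_in_Wf [OF th_Phi] v] Q_check_diff [OF \<zeta> ch_Q_check [OF \<kappa>(1)]] by blast
qed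

lemma Wa_decompose: "x \<in> Wa \<Longrightarrow> \<exists>v\<in>Wf. \<exists>\<zeta>\<in>Q_check D. x = v \<circ> transl D \<zeta>"
proof (induction rule: Wa_induct)
  case id
  have 0: "(\<lambda>_. 0) \<in> Q_check D" by (auto simp: Q_check_def intro!: exI [of _ "\<lambda>_. 0"])
  have "transl D (\<lambda>_. 0) \<mu> = \<mu>" for \<mu> by (simp add: transl_def nu_def)
  then have "id = id \<circ> transl D (\<lambda>_. 0)" by auto
  then show ?case using 0 Wf_id by blast
next
  case (srefl i x)
  then obtain v \<zeta> where v: "v \<in> Wf" "\<zeta> \<in> Q_check D" "x = v \<circ> transl D \<zeta>" by blast
  show ?case
  proof (cases "i = z0")
    case True
    then show ?thesis using s_z0_transl [OF v(1,2)] unfolding v(3) by blast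
  next
    case False
    then have "s i \<circ> v \<in> Wf" using v by (intro Wf_comp Wf_s) (auto simp: in_I)
    moreover have "s i \<circ> x = (s i \<circ> v) \<circ> transl D \<zeta>" by (simp add: v comp_assoc)
    ultimately show ?thesis using v(2) by blast
  qed
qed

subsection \<open>Real roots, coroots and semi-infinite length\<close>

abbreviation "R \<equiv> real_roots D"
abbreviation "Rp \<equiv> pos_real_roots D"

text \<open>On level zero \<open>s z0\<close> is \<open>rf th\<close> up to a multiple of
  \<open>dl\<close>, and \<open>dl\<close> lies in the radical of \<open>B\<close>.\<close>

lemma B_level_zero:
  assumes "x \<in> Wa" "c \<mu> = 0" "c \<nu> = 0" shows "B (x \<mu>) (x \<nu>) = B \<mu> \<nu>"
  using assms
proof (induction rule: Wa_induct)
  case (srefl i x)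
  have "B (s i \<mu>) (s i \<nu>) = B \<mu> \<nu>" if "c \<mu> = 0" "c \<nu> = 0" for \<mu> \<nu>
  proof (cases "i = z0")
    case True
    have "s z0 y = rf th y + ch th y \<cdot> dl" if "c y = 0" for y
      using that by (simp add: srefl_def ac_z0 rf_def th_def int_scale_minus
          int_module.scale_right_diff_distrib algebra_simps)
    then show ?thesis using that B_Wf [OF rf_in_Wf [OF th_Phi]] True by (simp add: B_simps)
  next
    case False
    then show ?thesis using B_Wf [OF Wf_s] by (simp add: in_I)
  qed
  then show ?case using srefl by simp
qed simp

lemma al_z0: "al z0 = dl - th"
  by (simp add: th_def)

lemma B_al_level_zero: "c y = 0 \<Longrightarrow> 2 * B (al j) y = B (al j) (al j) * ac j y"
  using B_al [of j y] ch_eq [OF th_Phi, of y]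
  by (cases "j = z0") (simp_all add: in_I al_z0 B_simps ac_z0)

lemma B_al_pos: "0 < B (al j) (al j)"
  using Phi_B_pos [OF Phi_al, of j] B_th_pos
  by (cases "j = z0") (simp_all add: in_I al_z0 B_simps)

lemma R_cases:
  assumes "\<beta> \<in> R" obtains \<gamma> n where "\<gamma> \<in> \<Phi>" "\<beta> = \<gamma> + n \<cdot> dl"
  using assms by (auto simp: real_roots_def)

lemma RI: "\<gamma> \<in> \<Phi> \<Longrightarrow> \<gamma> + n \<cdot> dl \<in> R"
  by (auto simp: real_roots_def)

lemma R_Q [simp]: "\<beta> \<in> R \<Longrightarrow> \<beta> \<in> Q"
  by (auto elim: R_cases)

lemma R_shift: "\<beta> \<in> R \<Longrightarrow> \<beta> + n \<cdot> dl \<in> R"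
proof -
  assume "\<beta> \<in> R"
  then obtain \<gamma> m where \<gamma>: "\<gamma> \<in> \<Phi>" "\<beta> = \<gamma> + m \<cdot> dl" by (rule R_cases)
  then have "\<beta> + n \<cdot> dl = \<gamma> + (m + n) \<cdot> dl" by (simp add: int_scale_add_left add.assoc)
  then show ?thesis using RI [OF \<gamma>(1)] by metis
qed

lemma R_minus: "\<beta> \<in> R \<Longrightarrow> - \<beta> \<in> R"
proof -
  assume "\<beta> \<in> R"
  then obtain \<gamma> m where \<gamma>: "\<gamma> \<in> \<Phi>" "\<beta> = \<gamma> + m \<cdot> dl" by (rule R_cases)
  then have "- \<beta> = - \<gamma> + (- m) \<cdot> dl" by (simp add: int_scale_minus)
  then show ?thesis using RI [OF Phi_minus [OF \<gamma>(1)]] by metis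
qed

lemma Phi_R: "\<gamma> \<in> \<Phi> \<Longrightarrow> \<gamma> \<in> R"
  using RI [of \<gamma> 0] by simp

lemma R_al: "al j \<in> R"
  using Phi_R [OF Phi_al, of j] RI [OF Phi_minus [OF th_Phi], of 1]
  by (cases "j = z0") (simp_all add: in_I al_z0 int_scale_one)

lemma R_s: assumes "\<beta> \<in> R" shows "s j \<beta> \<in> R"
proof -
  obtain \<gamma> m where \<gamma>: "\<gamma> \<in> \<Phi>" "\<beta> = \<gamma> + m \<cdot> dl" using assms by (rule R_cases)
  show ?thesis
  proof (cases "j = z0")
    case False
    then have "s j \<beta> = s j \<gamma> + m \<cdot> dl" by (simp add: \<gamma> s_add s_scale)
    then show ?thesis using RI Phi_s \<gamma>(1) False by (simp add: in_I)
  next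
    case True
    have "s z0 \<gamma> = rf th \<gamma> + ch th \<gamma> \<cdot> dl"
      using c_Q [of \<gamma>] \<gamma>(1) by (simp add: srefl_def ac_z0 rf_def al_z0 int_scale_minus
          int_module.scale_right_diff_distrib algebra_simps)
    then have "s j \<beta> = rf th \<gamma> + (ch th \<gamma> + m) \<cdot> dl"
      by (simp add: \<gamma> s_add s_scale True int_scale_add_left add.assoc)
    then show ?thesis using RI [OF Phi_Wf [OF rf_in_Wf [OF th_Phi] \<gamma>(1)]] by simp
  qed
qed

lemma R_Wa: "x \<in> Wa \<Longrightarrow> \<beta> \<in> R \<Longrightarrow> x \<beta> \<in> R"
  by (induction arbitrary: \<beta> rule: Wa_induct) (auto intro: R_s)

text \<open>The finite part \<gamma> of a real root \<gamma> + n \<delta>. Finite roots have no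
  coefficient at \<open>z0\<close> and \<open>a z0 = 1\<close>, so \<open>n\<close> is read off as
  \<open>cf \<beta> z0\<close>.\<close>

definition fp :: "'p \<Rightarrow> 'p"
  where "fp \<beta> = \<beta> - cf \<beta> z0 \<cdot> dl"

lemma fp_shift: "\<beta> \<in> Q \<Longrightarrow> fp (\<beta> + n \<cdot> dl) = fp \<beta>"
  by (simp add: fp_def cf_add cf_scale int_scale_add_left)

lemma fp_minus: "\<beta> \<in> Q \<Longrightarrow> fp (- \<beta>) = - fp \<beta>"
  by (simp add: fp_def cf_minus int_scale_minus)

lemma fp_Phi [simp]: "\<gamma> \<in> \<Phi> \<Longrightarrow> fp \<gamma> = \<gamma>"
  by (simp add: fp_def Phi_cf)

lemma fp_R: "\<beta> \<in> R \<Longrightarrow> fp \<beta> \<in> \<Phi>"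
  by (erule R_cases) (simp add: fp_shift)

lemma fp_eq: "fp \<beta> + cf \<beta> z0 \<cdot> dl = \<beta>"
  by (simp add: fp_def)

lemma Rp_iff: "\<beta> \<in> Rp \<longleftrightarrow> \<beta> \<in> R \<and> (0 < cf \<beta> z0 \<or> cf \<beta> z0 = 0 \<and> fp \<beta> \<in> \<Phi>p)"
proof
  assume "\<beta> \<in> Rp"
  then show "\<beta> \<in> R \<and> (0 < cf \<beta> z0 \<or> cf \<beta> z0 = 0 \<and> fp \<beta> \<in> \<Phi>p)"
    unfolding pos_real_roots_def
    by (auto simp: Phi_R Phi_pos Phi_cf RI cf_add cf_scale)
next
  assume \<beta>: "\<beta> \<in> R \<and> (0 < cf \<beta> z0 \<or> cf \<beta> z0 = 0 \<and> fp \<beta> \<in> \<Phi>p)"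
  show "\<beta> \<in> Rp"
  proof (cases "0 < cf \<beta> z0")
    case True
    then have "\<exists>\<alpha> n. \<beta> = \<alpha> + n \<cdot> dl \<and> \<alpha> \<in> \<Phi> \<and> 0 < n"
      using \<beta> fp_R fp_eq [of \<beta>] by metis
    then show ?thesis unfolding pos_real_roots_def by blast
  next
    case False
    then show ?thesis unfolding pos_real_roots_def using \<beta> by (auto simp: fp_def)
  qed
qed

lemma Rp_R: "\<beta> \<in> Rp \<Longrightarrow> \<beta> \<in> R"
  by (simp add: Rp_iff)

text \<open>For \<open>n > 0\<close> the coefficients of n \<delta> outweigh those of the finite
  part, by \<open>Phi_bound\<close>.\<close>

lemma Rp_cf: assumes "\<beta> \<in> Rp" shows "0 \<le> cf \<beta> i"
proof (cases "0 < cf \<beta> z0")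
  case True
  have "cf \<beta> i = cf (fp \<beta>) i + cf \<beta> z0 * a i"
    using Rp_R [OF assms] by (simp add: fp_def cf_diff cf_scale)
  moreover have "a i \<le> cf \<beta> z0 * a i" using True a_pos [of i] by (simp add: mult_le_cancel_right1)
  moreover have "- a i \<le> cf (fp \<beta>) i" using Phi_bound [OF fp_R [OF Rp_R [OF assms]], of i] by simp
  ultimately show ?thesis by simp
next
  case False
  then have "fp \<beta> \<in> \<Phi>p" "fp \<beta> = \<beta>" using assms by (auto simp: Rp_iff fp_def)
  then show ?thesis using Phi_pos(2) [of \<beta> i] by simp
qed

lemma R_sign: "\<beta> \<in> R \<Longrightarrow> \<beta> \<in> Rp \<or> - \<beta> \<in> Rp"
  using Phi_sign [OF fp_R, of \<beta>] by (auto simp: Rp_iff R_minus cf_minus fp_minus)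

lemma R_nonzero: "\<beta> \<in> R \<Longrightarrow> \<beta> \<noteq> 0"
  using Phi_nonzero [OF fp_R, of \<beta>] by (auto simp: fp_def)

lemma Rp_not_neg: assumes "\<beta> \<in> Rp" shows "- \<beta> \<notin> Rp"
proof
  assume "- \<beta> \<in> Rp"
  then have "cf \<beta> i = 0" for i
    using Rp_cf [OF assms, of i] Rp_cf [of "- \<beta>" i] Rp_R [OF assms] by (simp add: cf_minus)
  then have "\<beta> = 0" using Rp_R [OF assms] by (intro cf_eqI) auto
  then show False using R_nonzero [OF Rp_R [OF assms]] by simp
qed

lemma RpI: "\<beta> \<in> R \<Longrightarrow> 0 < cf \<beta> j \<Longrightarrow> \<beta> \<in> Rp"
  using R_sign [of \<beta>] Rp_cf [of "- \<beta>" j] by (auto simp: cf_minus)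

lemma al_Rp: "al j \<in> Rp"
  by (rule RpI [of _ j]) (simp_all add: R_al cf_al)

lemma R_multiple: assumes \<beta>: "\<beta> \<in> R" and eq: "\<beta> = m \<cdot> al j" shows "m = 1 \<or> m = -1"
proof (cases "j = z0")
  case True
  \<comment> \<open>Modulo \<delta> the affine simple root is -\<theta>, so the finite statement
    applies with the sign reversed.\<close>
  have "fp \<beta> = (- m) \<cdot> th"
    by (simp add: eq fp_def cf_scale True al_z0 cf_diff cf_th int_scale_minus
        int_module.scale_right_diff_distrib)
  then have "- m = 1 \<or> - m = -1" by (rule Phi_multiple [OF fp_R [OF \<beta>] th_Phi])
  then show ?thesis by auto
next
  case False
  then have j: "j \<in> I" by (simp add: in_I)
  have "fp \<beta> = m \<cdot> al j" using False by (simp add: eq fp_def cf_scale cf_al)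
  then show ?thesis by (rule Phi_multiple [OF fp_R [OF \<beta>] Phi_al [OF j]])
qed

lemma Rp_multiple:
  assumes \<beta>: "\<beta> \<in> Rp" and "\<And>i. i \<noteq> j \<Longrightarrow> cf \<beta> i = 0" shows "\<beta> = al j"
proof -
  have eq: "\<beta> = cf \<beta> j \<cdot> al j"
    using Rp_R [OF \<beta>] assms(2) by (intro cf_eqI) (auto simp: cf_scale cf_al)
  then have "cf \<beta> j = 1"
    using R_multiple [OF Rp_R [OF \<beta>] eq] Rp_cf [OF \<beta>, of j] by auto
  then show ?thesis using eq by (simp add: int_scale_one)
qed

lemma Rp_s: assumes \<beta>: "\<beta> \<in> Rp" "\<beta> \<noteq> al j" shows "s j \<beta> \<in> Rp"
proof -
  obtain i where "i \<noteq> j" "cf \<beta> i \<noteq> 0" using Rp_multiple [OF \<beta>(1), of j] \<beta>(2) by blast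
  then show ?thesis
    using Rp_R [OF \<beta>(1)] Rp_cf [OF \<beta>(1), of i] by (intro RpI [of _ i]) (auto simp: R_s cf_s)
qed

text \<open>If no simple coroot were positive on \<beta>, expanding one argument of
  \<open>B \<beta> \<beta>\<close> in simple roots would make this positive norm at most
  zero.\<close>

lemma Rp_descent: assumes \<beta>: "\<beta> \<in> Rp" obtains j where "0 < ac j \<beta>"
proof -
  have "\<exists>j. 0 < ac j \<beta>"
  proof (rule ccontr)
    assume "\<not> ?thesis"
    then have neg: "ac j \<beta> \<le> 0" for j by (simp add: not_less)
    have "B (fp \<beta>) (fp \<beta>) = B \<beta> \<beta>" by (simp add: fp_def B_simps)
    then have "0 < 2 * B \<beta> \<beta>" using Phi_B_pos [OF fp_R [OF Rp_R [OF \<beta>]]] by simp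
    also have "2 * B \<beta> \<beta> = 2 * B (rl (cf \<beta>)) \<beta>" using Rp_R [OF \<beta>] by simp
    also have "\<dots> = (\<Sum>j\<in>UNIV. cf \<beta> j * (2 * B (al j) \<beta>))"
      by (simp add: B_rl sum_distrib_left mult_ac)
    also have "\<dots> = (\<Sum>j\<in>UNIV. cf \<beta> j * (B (al j) (al j) * ac j \<beta>))"
      using c_Q [of \<beta>] Rp_R [OF \<beta>] by (simp add: B_al_level_zero)
    also have "\<dots> \<le> 0"
      using Rp_cf [OF \<beta>] neg B_al_pos by (intro sum_nonpos mult_nonneg_nonpos) (auto simp: less_imp_le)
    finally show False by simp
  qed
  then show thesis using that by blast
qed

text \<open>Induction on the height: \<open>s j\<close> lowers it by \<open>ac j \<beta>\<close>,
  and coefficients of positive roots are nonnegative, so \<open>nat\<close> loses nothing.\<close>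

lemma Rp_induct [consumes 1, case_names simple reflect]:
  assumes "\<beta> \<in> Rp" "\<And>j. P (al j)"
    "\<And>\<beta> j. \<beta> \<in> Rp \<Longrightarrow> \<beta> \<noteq> al j \<Longrightarrow> 0 < ac j \<beta> \<Longrightarrow> s j \<beta> \<in> Rp \<Longrightarrow> P (s j \<beta>) \<Longrightarrow> P \<beta>"
  shows "P \<beta>"
  using assms(1)
proof (induction "nat (\<Sum>i\<in>UNIV. cf \<beta> i)" arbitrary: \<beta> rule: less_induct)
  case less
  obtain j where j: "0 < ac j \<beta>" by (rule Rp_descent [OF less.prems])
  show ?case
  proof (cases "\<beta> = al j")
    case False
    have s: "s j \<beta> \<in> Rp" by (rule Rp_s [OF less.prems False])
    have "(\<Sum>i\<in>UNIV. cf (s j \<beta>) i) = (\<Sum>i\<in>UNIV. cf \<beta> i) - ac j \<beta>"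
      using Rp_R [OF less.prems] by (simp add: cf_s sum_subtractf)
    moreover have "0 \<le> (\<Sum>i\<in>UNIV. cf (s j \<beta>) i)" using Rp_cf [OF s] by (simp add: sum_nonneg)
    ultimately have "P (s j \<beta>)" using j by (intro less.hyps s) linarith
    then show ?thesis using assms(3) less.prems False j s by blast
  qed (simp add: assms(2))
qed

lemma Rp_orbit: "\<beta> \<in> Rp \<Longrightarrow> \<exists>w\<in>Wa. \<exists>j. \<beta> = w (al j)"
proof (induction rule: Rp_induct)
  case (simple j)
  show ?case by (intro bexI [of _ id] exI [of _ j]) (simp_all add: Wa_id)
next
  case (reflect \<beta> j)
  then obtain w i where w: "w \<in> Wa" "s j \<beta> = w (al i)" by blast
  then have "\<beta> = (s j \<circ> w) (al i)" using s_s [of j \<beta>] by simp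
  then show ?case using Wa_comp [OF Wa_s w(1)] by blast
qed

text \<open>
  A \<open>W\<^sub>a\<^sub>f\<close>-invariant pairing between the root lattice and \<open>P\<^sub>a\<^sub>f\<close>; unlike \<open>B\<close>, it separates
  coroots differing by a multiple of \<open>c\<close>.
\<close>

definition E :: "'p \<Rightarrow> 'p \<Rightarrow> int"
  where "E \<beta> y = (\<Sum>j\<in>UNIV. cf \<beta> j * (B (al j) (al j) * ac j y))"

lemma E_al: "E (al j) y = B (al j) (al j) * ac j y"
  by (simp add: E_def cf_al if_distrib [of "\<lambda>n. n * _"] cong: if_cong)

lemma A_symmetrizable: "B (al i) (al i) * A i j = B (al j) (al j) * A j i"
  using B_al_level_zero [of "al j" i] B_al_level_zero [of "al i" j]
  by (simp add: ac_al B_sym [of "al i" "al j"])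

lemma E_al_right: assumes "\<beta> \<in> Q" shows "E \<beta> (al j) = B (al j) (al j) * ac j \<beta>"
proof -
  have "E \<beta> (al j) = B (al j) (al j) * (\<Sum>i\<in>UNIV. A j i * cf \<beta> i)"
    unfolding E_def ac_al A_symmetrizable [of _ j] sum_distrib_left
    by (rule sum.cong) (simp_all add: mult_ac)
  also have "(\<Sum>i\<in>UNIV. A j i * cf \<beta> i) = ac j (rl (cf \<beta>))" by (simp add: ac_rl)
  finally show ?thesis using assms by simp
qed

lemma E_diff_scale: "E \<beta> (y - k \<cdot> z) = E \<beta> y - k * E \<beta> z"
  by (simp add: E_def right_diff_distrib sum_subtractf sum_distrib_left mult_ac)

lemma E_s_left: assumes "\<beta> \<in> Q"
  shows "E (s j \<beta>) z = E \<beta> z - ac j \<beta> * (B (al j) (al j) * ac j z)"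
  using assms by (simp add: E_def cf_s left_diff_distrib sum_subtractf
      if_distrib [of "\<lambda>n. n * _"] cong: if_cong)

lemma E_s: assumes "\<beta> \<in> Q" shows "E (s j \<beta>) (s j y) = E \<beta> y"
proof -
  have "E \<beta> (s j y) = E \<beta> y - ac j y * (B (al j) (al j) * ac j \<beta>)"
    by (simp add: srefl_def E_diff_scale E_al_right assms)
  then show ?thesis by (simp add: E_s_left assms ac_s algebra_simps)
qed

lemma E_Wa: "x \<in> Wa \<Longrightarrow> \<beta> \<in> Q \<Longrightarrow> E (x \<beta>) (x y) = E \<beta> y"
  by (induction arbitrary: \<beta> y rule: Wa_induct) (auto simp: E_s Wa_Q)

text \<open>The definite description does not depend on the chosen \<open>w\<close> and
  \<open>i\<close>: by invariance of \<open>E\<close>, every candidate \<open>h\<close> satisfies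
  \<open>h y * E \<beta> \<beta> = 2 * E \<beta> y\<close> with \<open>E \<beta> \<beta>\<close>
  positive.\<close>

lemma coroot_orbit: assumes w: "w \<in> Wa" shows "coroot D (w (al i)) (w \<mu>) = ac i \<mu>"
proof -
  let ?P = "\<lambda>h. \<exists>v\<in>Wa. \<exists>j. w (al i) = v (al j) \<and> (\<forall>\<mu>. h (v \<mu>) = ac j \<mu>)"
  obtain u where u: "u \<in> Wa" "\<And>x. u (w x) = x" "\<And>x. w (u x) = x"
    by (rule Wa_inverse [OF w]) blast
  have P: "?P (\<lambda>y. ac i (u y))"
    by (rule bexI [OF _ w]) (use u in auto)
  have eq: "h y * E \<beta> \<beta> = 2 * E \<beta> y"
    if v: "v \<in> Wa" "\<beta> = v (al j)" "\<forall>\<mu>. h (v \<mu>) = ac j \<mu>" for h v j \<beta> y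
  proof -
    obtain u where u: "u \<in> Wa" "\<And>x. u (v x) = x" "\<And>x. v (u x) = x"
      by (rule Wa_inverse [OF v(1)]) blast
    have "E \<beta> \<beta> = 2 * B (al j) (al j)" using v(1,2) by (simp add: E_Wa E_al)
    moreover have "E \<beta> (v (u y)) = B (al j) (al j) * ac j (u y)"
      using v(1,2) by (simp add: E_Wa E_al)
    moreover have "h (v (u y)) = ac j (u y)" using v(3) by blast
    ultimately show ?thesis using u(3) by simp
  qed
  have "E (w (al i)) (w (al i)) = 2 * B (al i) (al i)" using w by (simp add: E_Wa E_al)
  then have pos: "0 < E (w (al i)) (w (al i))" using B_al_pos [of i] by simp
  have unique: "h = g" if "?P h" "?P g" for h g
  proof
    fix y
    have "h y * E (w (al i)) (w (al i)) = 2 * E (w (al i)) y" using that(1) eq by blast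
    moreover have "g y * E (w (al i)) (w (al i)) = 2 * E (w (al i)) y" using that(2) eq by blast
    ultimately have "h y * E (w (al i)) (w (al i)) = g y * E (w (al i)) (w (al i))" by simp
    then show "h y = g y" using pos by simp
  qed
  have "coroot D (w (al i)) = (\<lambda>y. ac i (u y))"
    unfolding coroot_def by (rule the_equality [where P = ?P]) (fact P, rule unique [OF _ P])
  then show ?thesis by (simp add: u)
qed

abbreviation "co \<equiv> coroot D"
abbreviation "rr \<equiv> refl D"

lemma coroot_al: "co (al j) = ac j"
  using coroot_orbit [OF Wa_id, of j] by auto

lemma coroot_Wa: assumes "\<beta> \<in> Rp" "x \<in> Wa" shows "co (x \<beta>) (x y) = co \<beta> y"
proof -
  obtain w j where w: "w \<in> Wa" "\<beta> = w (al j)" using Rp_orbit [OF assms(1)] by blast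
  obtain u where u: "\<And>x. w (u x) = x" by (rule Wa_inverse [OF w(1)]) blast
  have "co (x \<beta>) (x y) = co ((x \<circ> w) (al j)) ((x \<circ> w) (u y))" by (simp add: w u)
  also have "\<dots> = ac j (u y)" by (rule coroot_orbit [OF Wa_comp [OF assms(2) w(1)]])
  also have "\<dots> = co \<beta> (w (u y))" by (simp add: w coroot_orbit)
  finally show ?thesis by (simp add: u)
qed

lemma coroot_s: "\<beta> \<in> Rp \<Longrightarrow> co (s j \<beta>) (s j y) = co \<beta> y"
  by (rule coroot_Wa [OF _ Wa_s])

lemma refl_al: "rr (al j) = s j"
  by (intro ext) (simp add: refl_def srefl_def coroot_al)

lemma refl_s: "\<beta> \<in> Rp \<Longrightarrow> s j (rr \<beta> y) = rr (s j \<beta>) (s j y)"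
  by (simp add: refl_def coroot_s s_diff s_scale)

lemma refl_orbit: "w \<in> Wa \<Longrightarrow> rr (w (al j)) (w y) = w (s j y)"
  by (simp add: refl_def coroot_orbit srefl_def Wa_diff Wa_scale)

lemma refl_in_Wa: assumes "\<beta> \<in> Rp" shows "rr \<beta> \<in> Wa"
proof -
  obtain w j where w: "w \<in> Wa" "\<beta> = w (al j)" using Rp_orbit [OF assms] by blast
  obtain u where u: "u \<in> Wa" "\<And>x. w (u x) = x" by (rule Wa_inverse [OF w(1)]) blast
  have "rr \<beta> = w \<circ> (s j \<circ> u)"
    using refl_orbit [OF w(1), of j "u _"] by (auto simp: u w fun_eq_iff)
  then show ?thesis using u w by (auto intro!: Wa_comp Wa_s)
qed

lemma refl_refl: assumes "\<beta> \<in> Rp" shows "rr \<beta> (rr \<beta> y) = y" "co \<beta> (rr \<beta> y) = - co \<beta> y"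
proof -
  obtain w j where w: "w \<in> Wa" "\<beta> = w (al j)" using Rp_orbit [OF assms] by blast
  obtain u where u: "u \<in> Wa" "\<And>x. w (u x) = x" by (rule Wa_inverse [OF w(1)]) blast
  have "rr \<beta> (rr \<beta> (w (u y))) = w (u y)" "co \<beta> (rr \<beta> (w (u y))) = - co \<beta> (w (u y))"
    unfolding w(2) refl_orbit [OF w(1)] coroot_orbit [OF w(1)] by (simp_all add: ac_s)
  then show "rr \<beta> (rr \<beta> y) = y" "co \<beta> (rr \<beta> y) = - co \<beta> y" by (simp_all add: u)
qed

lemma ac_refl: "ac j (rr \<beta> y) = ac j y - co \<beta> y * ac j \<beta>"
  by (simp add: refl_def)

section \<open>Depth of real roots and semi-infinite length\<close>

text \<open>The least \<open>m\<close> for which \<beta> + m \<delta> is positive, as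
  \<open>depth_le_iff\<close> confirms.\<close>

definition depth :: "'p \<Rightarrow> int"
  where "depth \<beta> = ng (fp \<beta>) - cf \<beta> z0"

lemma depth_le_iff: assumes "\<beta> \<in> R" shows "depth \<beta> \<le> m \<longleftrightarrow> \<beta> + m \<cdot> dl \<in> Rp"
proof -
  have "\<beta> + m \<cdot> dl \<in> R" by (rule R_shift [OF assms])
  then show ?thesis
    using assms Phi_sign [OF fp_R [OF assms]] Phi_not_pos [of "fp \<beta>"]
    by (auto simp: Rp_iff depth_def ng_def fp_shift cf_add cf_scale)
qed

lemma depth_shift: "\<beta> \<in> R \<Longrightarrow> depth (\<beta> + n \<cdot> dl) = depth \<beta> - n"
  by (simp add: depth_def fp_shift cf_add cf_scale)

lemma depth_al: "depth (al j) = 0" "depth (- al j) = 1"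
proof -
  have *: "depth (al j) = 0 \<and> depth (- al j) = 1"
  proof (cases "j = z0")
    case True
    have "fp (al z0) = - th" by (simp add: fp_def al_z0 cf_diff cf_th int_scale_one)
    then show ?thesis
      using th_pos Phi_not_pos [OF th_pos] by (simp add: True depth_def fp_minus cf_minus cf_al ng_def)
  next
    case False
    then have "al j \<in> \<Phi>p" by (simp add: in_I al_pos)
    then show ?thesis using Phi_not_pos [of "al j"] Phi_pos(1) [of "al j"] False
      by (simp add: depth_def fp_minus cf_minus cf_al ng_def)
  qed
  then show "depth (al j) = 0" "depth (- al j) = 1" by blast+
qed

text \<open>\<open>al j\<close> is the only positive root that \<open>s j\<close> makes negative. If
  \<beta> is not congruent to it or its negative modulo \<delta>, then \<beta> and
  \<open>s j \<beta>\<close> have the same positive shifts.\<close>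

lemma depth_s:
  assumes \<beta>: "\<beta> \<in> R" and neq: "fp \<beta> \<noteq> fp (al j)" "fp \<beta> \<noteq> - fp (al j)"
  shows "depth (s j \<beta>) = depth \<beta>"
proof -
  have "s j \<beta> + m \<cdot> dl \<in> Rp \<longleftrightarrow> \<beta> + m \<cdot> dl \<in> Rp" for m
  proof -
    have eq: "s j \<beta> + m \<cdot> dl = s j (\<beta> + m \<cdot> dl)" by (simp add: s_add s_scale)
    have fpm: "fp (\<beta> + m \<cdot> dl) = fp \<beta>" using \<beta> by (simp add: fp_shift)
    have "\<beta> + m \<cdot> dl \<noteq> al j" "s j (\<beta> + m \<cdot> dl) \<noteq> al j"
    proof -
      show "\<beta> + m \<cdot> dl \<noteq> al j" using fpm neq by auto
      show "s j (\<beta> + m \<cdot> dl) \<noteq> al j"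
      proof
        assume "s j (\<beta> + m \<cdot> dl) = al j"
        then have "\<beta> + m \<cdot> dl = - al j" using s_s [of j "\<beta> + m \<cdot> dl"] by simp
        then show False using fpm neq by (simp add: fp_minus)
      qed
    qed
    then show ?thesis
      using Rp_s [of "\<beta> + m \<cdot> dl" j] Rp_s [of "s j (\<beta> + m \<cdot> dl)" j] unfolding eq by auto
  qed
  then have "depth (s j \<beta>) \<le> m \<longleftrightarrow> depth \<beta> \<le> m" for m
    by (simp add: depth_le_iff \<beta> R_s)
  then show ?thesis by (meson order_antisym order_refl)
qed

text \<open>For \<open>x = v \<circ> transl D \<zeta>\<close>, the depth of
  \<open>x \<alpha>\<close> is the inversion indicator of \<open>v\<close> at \<alpha> plus
  \<open>\<zeta> \<alpha>\<close>. Every decomposition of \<open>x\<close> thus gives the same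
  number, which settles the definite description.\<close>

lemma si_length_depth:
  assumes "x \<in> Wa" shows "si_length D x = (\<Sum>\<alpha>\<in>\<Phi>p. depth (x \<alpha>))"
proof -
  have *: "int (weyl_length D v) + \<zeta> (\<Sum>\<alpha>\<in>\<Phi>p. \<alpha>) = (\<Sum>\<alpha>\<in>\<Phi>p. depth (x \<alpha>))"
    if v: "v \<in> Wf" and \<zeta>: "\<zeta> \<in> Q_check D" and x: "x = v \<circ> transl D \<zeta>" for v \<zeta>
  proof -
    have vW: "v \<in> Wa" using v W_fin_sub by blast
    have "depth (x \<alpha>) = ng (v \<alpha>) + \<zeta> \<alpha>" if "\<alpha> \<in> \<Phi>p" for \<alpha>
    proof -
      have \<alpha>: "\<alpha> \<in> \<Phi>" "v \<alpha> \<in> \<Phi>" using Phi_pos(1) [OF that] v by (auto intro: Phi_Wf)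
      then have "x \<alpha> = v \<alpha> + (- \<zeta> \<alpha>) \<cdot> dl"
        by (simp add: x transl_level_zero c_Q Wa_diff vW Wa_scale int_scale_minus)
      then show ?thesis using \<alpha>(2) by (simp only: depth_shift Phi_R) (simp add: depth_def Phi_cf)
    qed
    then show ?thesis
      by (simp add: sum.distrib weyl_length_inversions v additive.sum [OF Q_check_additive [OF \<zeta>]])
  qed
  obtain v \<zeta> where "v \<in> Wf" "\<zeta> \<in> Q_check D" "x = v \<circ> transl D \<zeta>" using Wa_decompose [OF assms] by blast
  then show ?thesis
    unfolding si_length_def using * by (intro the_equality) (auto simp: eq_commute)
qed

end

section \<open>Comparison of the two graphs\<close>

locale untwisted_dominant = untwisted D
  for D :: "('i::finite, 'p::ab_group_add) affine" +
  fixes lam :: 'p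
  assumes dominant: "lam \<in> P_plus D"
begin

abbreviation "J \<equiv> stab_nodes D lam"

lemma lam_sum: obtains m where "lam = (\<Sum>i\<in>I. int (m i) \<cdot> level_zero_weight D i)"
  using dominant by (auto simp: P_plus_def)

lemma c_lam [simp]: "c lam = 0"
proof -
  obtain m where m: "lam = (\<Sum>i\<in>I. int (m i) \<cdot> level_zero_weight D i)" by (rule lam_sum)
  have "c (\<Lambda> z0) = 1"
    by (simp add: central_def ac_fweight if_distrib [of "\<lambda>n. _ * n"] cong: if_cong)
  then have "c (level_zero_weight D i) = 0" for i by (simp add: level_zero_weight_def)
  then show ?thesis by (simp add: m additive.sum [OF c_additive])
qed

lemma ac_lam: assumes "j \<in> I" shows "0 \<le> ac j lam"
proof -
  obtain m where m: "lam = (\<Sum>i\<in>I. int (m i) \<cdot> level_zero_weight D i)" by (rule lam_sum)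
  have "0 \<le> ac j (level_zero_weight D i)" for i
    using assms by (auto simp: level_zero_weight_def ac_fweight in_I)
  then show ?thesis by (simp add: m ac_sum sum_nonneg)
qed

lemma B_lam: "\<alpha> \<in> \<Phi> \<Longrightarrow> 2 * B \<alpha> lam = (\<Sum>j\<in>UNIV. cf \<alpha> j * B (al j) (al j) * ac j lam)"
  using B_rl_fin [of "cf \<alpha>" lam] by (simp add: Phi_cf)

lemma B_lam_term:
  assumes "\<alpha> \<in> \<Phi>p" shows "0 \<le> cf \<alpha> j * B (al j) (al j) * ac j lam"
  using Phi_pos [OF assms] B_al_pos [of j] ac_lam [of j]
  by (cases "j = z0") (auto simp: Phi_cf in_I)

lemma B_lam_nonneg: "\<alpha> \<in> \<Phi>p \<Longrightarrow> 0 \<le> B \<alpha> lam"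
proof -
  assume \<alpha>: "\<alpha> \<in> \<Phi>p"
  have "0 \<le> 2 * B \<alpha> lam"
    unfolding B_lam [OF Phi_pos(1) [OF \<alpha>]] by (intro sum_nonneg B_lam_term \<alpha>)
  then show ?thesis by simp
qed

text \<open>All terms of the expansion are nonnegative, so each vanishes and \<alpha> is supported
  on the nodes that kill \<open>lam\<close>.\<close>

lemma B_lam_zero:
  assumes \<alpha>: "\<alpha> \<in> \<Phi>p" and 0: "B \<alpha> lam = 0" shows "\<alpha> \<in> J_roots D J"
proof -
  have "(\<Sum>j\<in>UNIV. cf \<alpha> j * B (al j) (al j) * ac j lam) = 0"
    using B_lam [OF Phi_pos(1) [OF \<alpha>]] 0 by simp
  then have "cf \<alpha> j * B (al j) (al j) * ac j lam = 0" for j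
    using sum_nonneg_eq_0_iff [of UNIV "\<lambda>j. cf \<alpha> j * B (al j) (al j) * ac j lam"] B_lam_term [OF \<alpha>]
    by simp
  then have "cf \<alpha> j = 0 \<or> ac j lam = 0" for j using B_al_pos [of j] by (metis less_irrefl mult_eq_0_iff)
  then have cf0: "cf \<alpha> j = 0" if "j \<notin> J" for j
    using that Phi_cf [OF Phi_pos(1) [OF \<alpha>]] by (cases "j = z0") (auto simp: stab_nodes_def in_I)
  have "\<alpha> = rl (cf \<alpha>)" using Phi_pos(1) [OF \<alpha>] by simp
  also have "\<dots> = (\<Sum>j\<in>J. cf \<alpha> j \<cdot> al j)"
    unfolding rl_def by (intro sum.mono_neutral_right) (auto simp: cf0)
  finally show ?thesis using Phi_pos(1) [OF \<alpha>] unfolding J_roots_def root_span_def by blast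
qed

text \<open>
  The semi-infinite length restricted to the positive roots outside \<open>\<Delta>\<^sub>J\<close>. Unlike
  the semi-infinite length itself it obeys \<open>len_s\<close> on all of \<open>W\<^sub>a\<^sub>f\<close>, and the two agree on \<open>(W\<^sup>J)\<^sub>a\<^sub>f\<close>.
\<close>

definition len :: "('p \<Rightarrow> 'p) \<Rightarrow> int"
  where "len x = (\<Sum>\<alpha> | \<alpha> \<in> \<Phi>p \<and> 0 < B \<alpha> lam. depth (x \<alpha>))"

text \<open>Let \<gamma> be the finite part of the preimage of \<open>al j\<close> under
  \<open>x\<close>. Only \<gamma> and -\<gamma> change depth, by 1 and -1. The sign of
  \<open>B \<gamma> lam\<close>, which is that of \<open>ac j (x lam)\<close>, decides which of
  them, if any, is counted in \<open>len\<close>.\<close>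

lemma len_s:
  assumes x: "x \<in> Wa" shows "len (s j \<circ> x) = len x + sgn (ac j (x lam))"
proof -
  obtain u where u: "u \<in> Wa" "\<And>y. u (x y) = y" "\<And>y. x (u y) = y"
    by (rule Wa_inverse [OF x]) blast
  define \<eta> where "\<eta> = u (al j)"
  define \<gamma> where "\<gamma> = fp \<eta>"
  define n where "n = cf \<eta> z0"
  have \<eta>: "\<eta> \<in> R" "x \<eta> = al j" using u R_Wa [OF u(1) R_al] by (simp_all add: \<eta>_def)
  have \<gamma>: "\<gamma> \<in> \<Phi>" unfolding \<gamma>_def by (rule fp_R [OF \<eta>(1)])
  have "x \<gamma> = x \<eta> - n \<cdot> dl"
    by (simp add: \<gamma>_def fp_def n_def Wa_diff [OF x] Wa_scale [OF x] Wa_dl [OF x])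
  then have x\<gamma>: "x \<gamma> = al j + (- n) \<cdot> dl" by (simp add: \<eta> int_scale_minus)
  have x\<gamma>': "x (- \<gamma>) = - al j + n \<cdot> dl" by (simp add: Wa_minus [OF x] x\<gamma> int_scale_minus)
  define diff where "diff = (\<lambda>\<alpha>. depth (s j (x \<alpha>)) - depth (x \<alpha>))"
  have diff1: "diff \<gamma> = 1"
    unfolding diff_def x\<gamma> s_add s_scale s_al s_dl
    by (simp only: depth_shift R_al R_minus depth_al)
  have diff2: "diff (- \<gamma>) = - 1"
    unfolding diff_def x\<gamma>' s_add s_scale s_al s_dl s_minus minus_minus
    by (simp only: depth_shift R_al R_minus depth_al)
  \<comment> \<open>\<open>x\<close> is injective and fixes \<open>dl\<close>, so \<gamma> is the
    only finite root sent to \<open>al j\<close> modulo \<delta>.\<close>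
  have key: "\<alpha> = \<gamma>" if "\<alpha> \<in> \<Phi>" "fp (x \<alpha>) = fp (al j)" for \<alpha>
  proof -
    define m where "m = cf (x \<alpha>) z0 - cf (al j) z0"
    have "x \<alpha> = al j + m \<cdot> dl"
      using that(2) by (simp add: m_def fp_def int_module.scale_left_diff_distrib algebra_simps)
    then have "x \<alpha> = x (\<eta> + m \<cdot> dl)"
      by (simp add: Wa_add [OF x] Wa_scale [OF x] Wa_dl [OF x] \<eta>)
    then have "\<alpha> = \<eta> + m \<cdot> dl" by (rule Wa_inj [OF x])
    then show "\<alpha> = \<gamma>" using fp_shift [of \<eta> m] \<eta>(1) fp_Phi [OF that(1)] by (simp add: \<gamma>_def)
  qed
  have diff0: "diff \<alpha> = 0" if "\<alpha> \<in> \<Phi>" "\<alpha> \<noteq> \<gamma>" "\<alpha> \<noteq> - \<gamma>" for \<alpha>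
  proof -
    have "x \<alpha> \<in> R" by (rule R_Wa [OF x Phi_R [OF that(1)]])
    moreover have "fp (x \<alpha>) \<noteq> fp (al j)" using key that by blast
    moreover have "fp (x \<alpha>) \<noteq> - fp (al j)"
    proof
      assume "fp (x \<alpha>) = - fp (al j)"
      then have "fp (x (- \<alpha>)) = fp (al j)"
        using \<open>x \<alpha> \<in> R\<close> by (simp add: Wa_minus [OF x] fp_minus)
      then have "- \<alpha> = \<gamma>" using key Phi_minus that(1) by blast
      then show False using that(3) by (metis minus_minus)
    qed
    ultimately show ?thesis by (simp add: diff_def depth_s)
  qed
  have B: "2 * B \<gamma> lam = B (al j) (al j) * ac j (x lam)"
  proof -
    have "B \<gamma> lam = B \<eta> lam" by (simp add: \<gamma>_def fp_def B_simps)
    also have "\<dots> = B (x \<eta>) (x lam)"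
      using \<eta>(1) by (simp add: B_level_zero [OF x] c_Q)
    finally show ?thesis using B_al_level_zero [of "x lam" j] x by (simp add: \<eta>)
  qed
  let ?S = "{\<alpha> \<in> \<Phi>p. 0 < B \<alpha> lam}"
  have pos: "\<gamma> \<in> ?S \<longleftrightarrow> 0 < ac j (x lam)"
  proof -
    have "0 < B \<gamma> lam \<longleftrightarrow> 0 < B (al j) (al j) * ac j (x lam)" using B by linarith
    also have "\<dots> \<longleftrightarrow> 0 < ac j (x lam)" using B_al_pos [of j] by (simp add: zero_less_mult_iff)
    finally have "0 < B \<gamma> lam \<longleftrightarrow> 0 < ac j (x lam)" .
    moreover have "\<gamma> \<in> \<Phi>p" if "0 < B \<gamma> lam"
      using that Phi_sign [OF \<gamma>] B_lam_nonneg [of "- \<gamma>"] by (auto simp: B_simps)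
    ultimately show ?thesis by blast
  qed
  have neg: "- \<gamma> \<in> ?S \<longleftrightarrow> ac j (x lam) < 0"
  proof -
    have "B \<gamma> lam < 0 \<longleftrightarrow> B (al j) (al j) * ac j (x lam) < 0" using B by linarith
    also have "\<dots> \<longleftrightarrow> ac j (x lam) < 0" using B_al_pos [of j] by (simp add: mult_less_0_iff)
    finally have "B \<gamma> lam < 0 \<longleftrightarrow> ac j (x lam) < 0" .
    moreover have "- \<gamma> \<in> \<Phi>p" if "B \<gamma> lam < 0"
      using that Phi_sign [OF \<gamma>] B_lam_nonneg [of \<gamma>] by auto
    ultimately show ?thesis by (auto simp: B_simps)
  qed
  have "len (s j \<circ> x) - len x = (\<Sum>\<alpha>\<in>?S. diff \<alpha>)"
    by (simp add: len_def diff_def sum_subtractf)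
  also have "\<dots> = (\<Sum>\<alpha>\<in>?S. (if \<alpha> = \<gamma> then 1 else 0) - (if \<alpha> = - \<gamma> then 1 else 0))"
  proof (rule sum.cong [OF refl])
    fix \<alpha> assume "\<alpha> \<in> ?S"
    then have "\<alpha> \<in> \<Phi>" by (auto intro: Phi_pos)
    moreover have "\<gamma> \<noteq> - \<gamma>" using diff1 diff2 by auto
    ultimately show "diff \<alpha> = (if \<alpha> = \<gamma> then 1 else 0) - (if \<alpha> = - \<gamma> then 1 else 0)"
      using diff0 diff1 diff2 by auto
  qed
  also have "\<dots> = (if \<gamma> \<in> ?S then 1 else 0) - (if - \<gamma> \<in> ?S then 1 else 0)"
    by (simp add: sum_subtractf)
  also have "\<dots> = sgn (ac j (x lam))" unfolding pos neg by (simp add: sgn_if)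
  finally show ?thesis by simp
qed

lemma WJ_Wa: "x \<in> WJ_af D J \<Longrightarrow> x \<in> Wa"
  by (simp add: WJ_af_def)

text \<open>The omitted roots \<alpha> lie in \<Delta>_J. Both \<alpha> and -\<alpha> + \<delta>
  belong to its positive affine roots, so \<open>x\<close> keeps both positive and the depth of
  \<open>x \<alpha>\<close> is exactly 0.\<close>

lemma len_si_length:
  assumes x: "x \<in> WJ_af D J" shows "si_length D x = len x"
proof -
  have xW: "x \<in> Wa" by (rule WJ_Wa [OF x])
  have "depth (x \<alpha>) = 0" if \<alpha>: "\<alpha> \<in> \<Phi>p" "\<not> 0 < B \<alpha> lam" for \<alpha>
  proof -
    have \<alpha>J: "\<alpha> \<in> J_roots D J"
      using B_lam_zero [OF \<alpha>(1)] B_lam_nonneg [OF \<alpha>(1)] \<alpha>(2) by simp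
    have \<alpha>\<Phi>: "\<alpha> \<in> \<Phi>" by (rule Phi_pos(1) [OF \<alpha>(1)])
    have R: "x \<alpha> \<in> R" by (rule R_Wa [OF xW Phi_R [OF \<alpha>\<Phi>]])
    have "- \<alpha> \<in> J_roots D J"
    proof -
      obtain k where "\<alpha> = (\<Sum>i\<in>J. k i \<cdot> al i)" using \<alpha>J by (auto simp: J_roots_def root_span_def)
      then have "- \<alpha> = (\<Sum>i\<in>J. (- k i) \<cdot> al i)" by (simp add: int_scale_minus sum_negf)
      then have "- \<alpha> \<in> root_span D J"
        unfolding root_span_def by (intro CollectI exI [of _ "\<lambda>i. - k i"] conjI TrueI)
      then show ?thesis using Phi_minus [OF \<alpha>\<Phi>] by (simp add: J_roots_def)
    qed
    then have "- \<alpha> + 1 \<cdot> dl \<in> J_pos_real_roots D J"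
      using Phi_minus [OF \<alpha>\<Phi>] zero_less_one
      unfolding J_pos_real_roots_def pos_real_roots_def by blast
    then have "x (- \<alpha> + 1 \<cdot> dl) \<in> Rp" using x by (simp add: WJ_af_def)
    moreover have "x (- \<alpha> + 1 \<cdot> dl) = - (x \<alpha> + (- 1) \<cdot> dl)"
      by (simp add: Wa_diff [OF xW] Wa_dl [OF xW] int_scale_minus)
    ultimately have "x \<alpha> + (- 1) \<cdot> dl \<notin> Rp" using Rp_not_neg by metis
    then have "\<not> depth (x \<alpha>) \<le> - 1" using depth_le_iff [OF R] by blast
    moreover have "\<alpha> \<in> J_pos_real_roots D J"
    proof -
      have "\<alpha> = \<alpha> + 0 \<cdot> dl" by simp
      then show ?thesis
        using \<alpha>J \<alpha>(1) unfolding J_pos_real_roots_def pos_real_roots_def by blast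
    qed
    then have "x \<alpha> \<in> Rp" using x by (simp add: WJ_af_def)
    then have "depth (x \<alpha>) \<le> 0" using depth_le_iff [OF R, of 0] by simp
    ultimately show ?thesis by simp
  qed
  then show ?thesis
    unfolding si_length_depth [OF xW] len_def by (intro sum.mono_neutral_right) auto
qed

lemma len_refl_aux:
  assumes \<beta>: "\<beta> \<in> Rp" and x: "x \<in> Wa"
  shows "len (rr (s j \<beta>) \<circ> (s j \<circ> x)) - len (s j \<circ> x) =
    len (rr \<beta> \<circ> x) - len x + sgn (ac j (rr \<beta> (x lam))) - sgn (ac j (x lam))"
proof -
  have "rr (s j \<beta>) \<circ> (s j \<circ> x) = s j \<circ> (rr \<beta> \<circ> x)" by (simp add: fun_eq_iff refl_s [OF \<beta>])
  then show ?thesis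
    using len_s [OF x, of j] len_s [OF Wa_comp [OF refl_in_Wa [OF \<beta>] x], of j] by simp
qed

text \<open>Conjugating by \<open>s j\<close> alters the change of length by a difference of signs,
  which is at most 0 for a positive pairing and 0 for a zero one. The second claim later excludes
  edges with zero pairing.\<close>

lemma len_refl:
  assumes "\<beta> \<in> Rp" "x \<in> Wa"
  shows "0 < co \<beta> (x lam) \<Longrightarrow> len x < len (rr \<beta> \<circ> x)"
    and "co \<beta> (x lam) = 0 \<Longrightarrow> len (rr \<beta> \<circ> x) = len x"
proof -
  have "(0 < co \<beta> (x lam) \<longrightarrow> len x < len (rr \<beta> \<circ> x)) \<and>
      (co \<beta> (x lam) = 0 \<longrightarrow> len (rr \<beta> \<circ> x) = len x)"
    using assms
  proof (induction arbitrary: x rule: Rp_induct)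
    case (simple j)
    then show ?case unfolding refl_al coroot_al len_s [OF simple] by simp
  next
    case (reflect \<beta> j)
    let ?y = "s j \<circ> x" and ?n = "co \<beta> (x lam)"
    let ?d = "len (rr (s j \<beta>) \<circ> ?y) - len ?y"
    have "co (s j \<beta>) (?y lam) = ?n" using reflect.hyps by (simp add: coroot_s)
    then have IH: "(0 < ?n \<longrightarrow> len ?y < len (rr (s j \<beta>) \<circ> ?y)) \<and>
        (?n = 0 \<longrightarrow> len (rr (s j \<beta>) \<circ> ?y) = len ?y)"
      using reflect.IH [OF Wa_comp [OF Wa_s reflect.prems]] by metis
    have ac: "ac j (rr \<beta> (x lam)) = ac j (x lam) - ?n * ac j \<beta>" by (rule ac_refl)
    have aux: "?d = len (rr \<beta> \<circ> x) - len x + sgn (ac j (rr \<beta> (x lam))) - sgn (ac j (x lam))"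
      by (rule len_refl_aux [OF reflect.hyps(1) reflect.prems])
    show ?case
    proof (intro conjI impI)
      assume n: "0 < ?n"
      then have "ac j (rr \<beta> (x lam)) < ac j (x lam)" using ac reflect.hyps by simp
      then have "sgn (ac j (rr \<beta> (x lam))) \<le> sgn (ac j (x lam))" by (simp add: sgn_if)
      moreover have "0 < ?d" using IH n by simp
      ultimately show "len x < len (rr \<beta> \<circ> x)" using aux by linarith
    next
      assume n: "?n = 0"
      then have "ac j (rr \<beta> (x lam)) = ac j (x lam)" using ac by simp
      then have "?d = len (rr \<beta> \<circ> x) - len x" unfolding aux by simp
      then show "len (rr \<beta> \<circ> x) = len x" using IH n by linarith
    qed
  qed
  then show "0 < co \<beta> (x lam) \<Longrightarrow> len x < len (rr \<beta> \<circ> x)"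
    and "co \<beta> (x lam) = 0 \<Longrightarrow> len (rr \<beta> \<circ> x) = len x" by blast+
qed

section \<open>The order on the orbit and its covers\<close>

definition step :: "'p \<Rightarrow> 'p \<Rightarrow> bool"
  where "step \<mu> \<nu> \<longleftrightarrow> \<mu> \<in> orbit D lam \<and> \<nu> \<in> orbit D lam \<and>
    (\<exists>\<beta>\<in>Rp. \<nu> = rr \<beta> \<mu> \<and> 0 < co \<beta> \<mu>)"

abbreviation le (infix "\<preceq>" 50) where "le \<equiv> ls_le D lam"
abbreviation less (infix "\<prec>" 50) where "less \<equiv> ls_less D lam"

lemma ls_le_step: "ls_le D lam = step\<^sup>*\<^sup>*"
  by (simp add: ls_le_def step_def [abs_def])

lemma le_refl [simp]: "\<mu> \<preceq> \<mu>"
  by (simp add: ls_le_step)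

lemma le_trans: "\<mu> \<preceq> \<nu> \<Longrightarrow> \<nu> \<preceq> \<kappa> \<Longrightarrow> \<mu> \<preceq> \<kappa>"
  by (simp add: ls_le_step)

lemma step_le: "step \<mu> \<nu> \<Longrightarrow> \<mu> \<preceq> \<nu>"
  by (simp add: ls_le_step)

lemma orbitI: "x \<in> Wa \<Longrightarrow> x lam \<in> orbit D lam"
  by (auto simp: orbit_def)

lemma orbit_Wa: "w \<in> Wa \<Longrightarrow> \<mu> \<in> orbit D lam \<Longrightarrow> w \<mu> \<in> orbit D lam"
  unfolding orbit_def using Wa_comp [of w] by (force simp: o_def)

lemma stepI:
  "\<beta> \<in> Rp \<Longrightarrow> \<mu> \<in> orbit D lam \<Longrightarrow> 0 < co \<beta> \<mu> \<Longrightarrow> step \<mu> (rr \<beta> \<mu>)"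
  using orbit_Wa [OF refl_in_Wa] by (auto simp: step_def)

text \<open>Each upward step subtracts a positive multiple of a positive root. Antisymmetry
  follows.\<close>

lemma le_cf: "\<mu> \<preceq> \<nu> \<Longrightarrow> \<mu> - \<nu> \<in> Q \<and> (\<forall>i. 0 \<le> cf (\<mu> - \<nu>) i)"
  unfolding ls_le_step
proof (induction rule: rtranclp_induct)
  case (step \<nu> \<kappa>)
  then obtain \<beta> where \<beta>: "\<beta> \<in> Rp" "\<kappa> = rr \<beta> \<nu>" "0 < co \<beta> \<nu>" by (auto simp: step_def)
  then have eq: "\<mu> - \<kappa> = (\<mu> - \<nu>) + co \<beta> \<nu> \<cdot> \<beta>" by (simp add: refl_def)
  show ?case
    unfolding eq using step.IH \<beta>(3) Rp_R [OF \<beta>(1)] Rp_cf [OF \<beta>(1)] by (simp add: cf_add cf_scale)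
qed simp

lemma le_antisym: assumes "\<mu> \<preceq> \<nu>" "\<nu> \<preceq> \<mu>" shows "\<mu> = \<nu>"
proof -
  have *: "\<mu> - \<nu> \<in> Q" using le_cf [OF assms(1)] by blast
  have "\<nu> - \<mu> = - (\<mu> - \<nu>)" by simp
  then have "cf (\<nu> - \<mu>) i = - cf (\<mu> - \<nu>) i" for i using cf_minus [OF *] by metis
  then have "cf (\<mu> - \<nu>) i = 0" for i
    using le_cf [OF assms(1)] le_cf [OF assms(2)] by (metis neg_0_le_iff_le order_antisym)
  then have "\<mu> - \<nu> = 0" using * by (intro cf_eqI) auto
  then show ?thesis by simp
qed

lemma step_neq: assumes "step \<mu> \<nu>" shows "\<mu> \<noteq> \<nu>"
proof
  assume "\<mu> = \<nu>"
  then obtain \<beta> where \<beta>: "\<beta> \<in> Rp" "co \<beta> \<mu> \<cdot> \<beta> = 0" "0 < co \<beta> \<mu>"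
    using assms by (auto simp: step_def refl_def)
  then have "cf \<beta> i = 0" for i using cf_scale [of \<beta> "co \<beta> \<mu>" i] Rp_R [OF \<beta>(1)] by simp
  then have "\<beta> = 0" using Rp_R [OF \<beta>(1)] by (intro cf_eqI) auto
  then show False using R_nonzero [OF Rp_R [OF \<beta>(1)]] by simp
qed

lemma step_less: "step \<mu> \<nu> \<Longrightarrow> \<mu> \<prec> \<nu>"
  by (simp add: ls_less_def step_le step_neq)

lemma less_le_trans: "\<mu> \<prec> \<nu> \<Longrightarrow> \<nu> \<preceq> \<kappa> \<Longrightarrow> \<mu> \<prec> \<kappa>"
  unfolding ls_less_def using le_trans le_antisym by blast

lemma step_s:
  assumes "step \<mu> \<nu>" "\<nu> \<noteq> s j \<mu>" shows "step (s j \<mu>) (s j \<nu>)"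
proof -
  obtain \<beta> where \<beta>: "\<beta> \<in> Rp" "\<nu> = rr \<beta> \<mu>" "0 < co \<beta> \<mu>" and \<mu>: "\<mu> \<in> orbit D lam"
    using assms(1) by (auto simp: step_def)
  have "\<beta> \<noteq> al j" using assms(2) \<beta>(2) by (auto simp: refl_al)
  then have "s j \<beta> \<in> Rp" by (rule Rp_s [OF \<beta>(1)])
  then have "step (s j \<mu>) (rr (s j \<beta>) (s j \<mu>))"
    using \<beta> \<mu> by (intro stepI orbit_Wa [OF Wa_s]) (simp_all add: coroot_s)
  then show ?thesis by (simp add: \<beta> refl_s)
qed

text \<open>Follow the chain: a step from \<nu> to \<open>s j \<nu>\<close> exchanges the two
  alternatives, and every other step is conjugated by \<open>s j\<close> and preserves them.\<close>

lemma le_s: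
  "\<mu> \<preceq> \<nu> \<Longrightarrow> s j \<mu> \<preceq> s j \<nu> \<or> (s j \<mu> \<preceq> \<nu> \<and> \<mu> \<preceq> s j \<nu>)"
  unfolding ls_le_step
proof (induction rule: rtranclp_induct)
  case (step \<nu> \<kappa>)
  show ?case
  proof (cases "\<kappa> = s j \<nu>")
    case True
    then have "\<nu> = s j \<kappa>" by simp
    then show ?thesis using step True by (metis rtranclp.rtrancl_into_rtrancl)
  next
    case False
    then show ?thesis using step step_s [OF step.hyps(2), of j]
      by (meson rtranclp.rtrancl_into_rtrancl)
  qed
qed simp

text \<open>The first step towards any intermediate weight uses a root \<beta> with a positive
  multiple below a multiple of \<open>al j\<close>, coefficient by coefficient; so \<beta> is
  \<open>al j\<close>.\<close>

lemma covers_simple: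
  assumes \<mu>: "\<mu> \<in> orbit D lam" and pos: "0 < ac j \<mu>" shows "ls_covers D lam \<mu> (s j \<mu>)"
proof -
  have st: "step \<mu> (s j \<mu>)" using stepI [OF al_Rp \<mu>, of j] pos by (simp add: coroot_al refl_al)
  have "\<kappa> = s j \<mu>" if \<kappa>: "\<mu> \<prec> \<kappa>" "\<kappa> \<preceq> s j \<mu>" for \<kappa>
  proof -
    obtain \<nu> where \<nu>: "step \<mu> \<nu>" "\<nu> \<preceq> \<kappa>"
      using \<kappa>(1) unfolding ls_less_def ls_le_step by (metis converse_rtranclpE)
    then obtain \<beta> where \<beta>: "\<beta> \<in> Rp" "\<nu> = rr \<beta> \<mu>" "0 < co \<beta> \<mu>" by (auto simp: step_def)
    have le: "\<nu> \<preceq> s j \<mu>" by (rule le_trans [OF \<nu>(2) \<kappa>(2)])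
    have "cf \<beta> i = 0" if "i \<noteq> j" for i
    proof -
      have "ac j \<mu> \<cdot> al j = (\<nu> - s j \<mu>) + co \<beta> \<mu> \<cdot> \<beta>" by (simp add: \<beta> refl_def srefl_def)
      then have "cf (ac j \<mu> \<cdot> al j) i = cf ((\<nu> - s j \<mu>) + co \<beta> \<mu> \<cdot> \<beta>) i" by simp
      then have "0 = cf (\<nu> - s j \<mu>) i + co \<beta> \<mu> * cf \<beta> i"
        using le_cf [OF le] Rp_R [OF \<beta>(1)] that by (simp add: cf_add cf_scale cf_al)
      moreover have "0 \<le> cf (\<nu> - s j \<mu>) i" using le_cf [OF le] by blast
      moreover have "0 \<le> co \<beta> \<mu> * cf \<beta> i" using Rp_cf [OF \<beta>(1), of i] \<beta>(3) by simp
      ultimately have "co \<beta> \<mu> * cf \<beta> i = 0" by linarith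
      then show ?thesis using \<beta>(3) by simp
    qed
    then have "\<beta> = al j" by (rule Rp_multiple [OF \<beta>(1)])
    then have "\<nu> = s j \<mu>" by (simp add: \<beta> refl_al)
    then show ?thesis using \<nu>(2) \<kappa>(2) le_antisym by blast
  qed
  then show ?thesis
    using \<mu> orbit_Wa [OF Wa_s \<mu>] step_less [OF st] unfolding ls_covers_def ls_less_def by blast
qed

lemma covers_s:
  assumes \<mu>: "\<mu> \<in> orbit D lam" and \<beta>: "\<beta> \<in> Rp" "\<beta> \<noteq> al j" "0 < co \<beta> \<mu>"
    and sgn: "sgn (ac j \<mu>) = sgn (ac j (rr \<beta> \<mu>))" "ac j \<mu> \<noteq> 0"
    and cov: "ls_covers D lam (s j \<mu>) (s j (rr \<beta> \<mu>))"
  shows "ls_covers D lam \<mu> (rr \<beta> \<mu>)"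
proof -
  define \<nu> where "\<nu> = rr \<beta> \<mu>"
  have st: "step \<mu> \<nu>" unfolding \<nu>_def by (rule stepI [OF \<beta>(1) \<mu> \<beta>(3)])
  have \<nu>: "\<nu> \<in> orbit D lam" using st by (simp add: step_def)
  have between: "\<kappa> = s j \<mu> \<or> \<kappa> = s j \<nu>" if "s j \<mu> \<preceq> \<kappa>" "\<kappa> \<preceq> s j \<nu>" "\<kappa> \<in> orbit D lam" for \<kappa>
    using cov that unfolding ls_covers_def \<nu>_def [symmetric] ls_less_def by metis
  have neq: "\<nu> \<noteq> s j \<mu>"
  proof
    assume "\<nu> = s j \<mu>"
    then have eq: "co \<beta> \<mu> \<cdot> \<beta> = ac j \<mu> \<cdot> al j" by (simp add: \<nu>_def refl_def srefl_def)
    have "cf \<beta> i = 0" if "i \<noteq> j" for i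
    proof -
      have "co \<beta> \<mu> * cf \<beta> i = cf (ac j \<mu> \<cdot> al j) i"
        using Rp_R [OF \<beta>(1)] by (simp add: cf_scale flip: eq)
      then show ?thesis using that \<beta>(3) by (simp add: cf_scale cf_al)
    qed
    then show False using Rp_multiple [OF \<beta>(1)] \<beta>(2) by blast
  qed
  have "\<not> (\<mu> \<prec> \<kappa> \<and> \<kappa> \<prec> \<nu>)" if \<kappa>: "\<kappa> \<in> orbit D lam" for \<kappa>
  proof
    assume less: "\<mu> \<prec> \<kappa> \<and> \<kappa> \<prec> \<nu>"
    then have le: "\<mu> \<preceq> \<kappa>" "\<kappa> \<preceq> \<nu>" by (simp_all add: ls_less_def)
    show False
    proof (cases "s j \<mu> \<preceq> s j \<kappa> \<and> s j \<kappa> \<preceq> s j \<nu>")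
      case True
      then have "s j \<kappa> = s j \<mu> \<or> s j \<kappa> = s j \<nu>" using between orbit_Wa [OF Wa_s \<kappa>] by blast
      then have "\<kappa> = \<mu> \<or> \<kappa> = \<nu>" by (metis s_s)
      then show False using less by (auto simp: ls_less_def)
    next
      case False
      \<comment> \<open>In this case at least one of the two comparisons takes the crossed
        alternative of \<open>le_s\<close>; composing it with either form of the other gives both
        relations.\<close>
      have "s j \<mu> \<preceq> \<nu> \<and> \<mu> \<preceq> s j \<nu>"
        using le_s [OF le(1), of j] le_s [OF le(2), of j] le False le_trans by blast
      then have crossed: "s j \<mu> \<preceq> \<nu>" "\<mu> \<preceq> s j \<nu>" by auto
      \<comment> \<open>For positive sign \<nu> lies between \<open>s j \<mu>\<close> and
        \<open>s j \<nu>\<close>, for negative sign \<mu> does. Since the interval has only its two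
        ends, both cases give \<open>\<nu> = s j \<mu>\<close>.\<close>
      show False
      proof (cases "0 < ac j \<mu>")
        case True
        then have "0 < ac j \<nu>" using sgn by (simp add: \<nu>_def sgn_if split: if_splits)
        then have "step \<nu> (s j \<nu>)" using stepI [OF al_Rp \<nu>, of j] by (simp add: coroot_al refl_al)
        then have "\<nu> = s j \<mu>" using between [OF crossed(1) _ \<nu>] step_le step_neq by blast
        then show False using neq by simp
      next
        case False
        then have "0 < ac j (s j \<mu>)" using sgn(2) by (simp add: ac_s)
        then have "step (s j \<mu>) (s j (s j \<mu>))"
          using stepI [OF al_Rp orbit_Wa [OF Wa_s \<mu>], of j j] by (simp add: coroot_al refl_al)
        then have "step (s j \<mu>) \<mu>" by simp
        then have "\<mu> = s j \<nu>" using between [OF _ crossed(2) \<mu>] step_le step_neq by metis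
        then show False using neq by simp
      qed
    qed
  qed
  then show ?thesis
    using \<mu> \<nu> step_less [OF st] unfolding ls_covers_def \<nu>_def [symmetric] by blast
qed

lemma covers_refl:
  assumes "\<beta> \<in> Rp" "x \<in> Wa" "0 < co \<beta> (x lam)" "len (rr \<beta> \<circ> x) = len x + 1"
  shows "ls_covers D lam (x lam) (rr \<beta> (x lam))"
  using assms
proof (induction arbitrary: x rule: Rp_induct)
  case (simple j)
  then show ?case using covers_simple [OF orbitI] by (simp add: refl_al coroot_al)
next
  case (reflect \<beta> j)
  let ?y = "s j \<circ> x"
  have y: "?y \<in> Wa" by (rule Wa_comp [OF Wa_s reflect.prems(1)])
  have co: "co (s j \<beta>) (?y lam) = co \<beta> (x lam)" using reflect by (simp add: coroot_s)
  have ac: "ac j (rr \<beta> (x lam)) = ac j (x lam) - co \<beta> (x lam) * ac j \<beta>" by (rule ac_refl)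
  moreover have "0 < co \<beta> (x lam) * ac j \<beta>" using reflect by simp
  moreover have aux: "len (rr (s j \<beta>) \<circ> ?y) - len ?y =
      1 + sgn (ac j (rr \<beta> (x lam))) - sgn (ac j (x lam))"
    using len_refl_aux [OF reflect.hyps(1) reflect.prems(1), of j] reflect.prems(3) by simp
  moreover have "len ?y < len (rr (s j \<beta>) \<circ> ?y)"
    using len_refl(1) [OF reflect.hyps(4) y] co reflect.prems(2) by simp
  \<comment> \<open>The pairing with \<open>al j\<close> falls strictly from \<open>x lam\<close> to
    \<open>rr \<beta> (x lam)\<close>. A drop in sign would make the left side of \<open>aux\<close>
    nonpositive, so the sign is constant, and a strict fall within one sign excludes zero.\<close>
  ultimately have sgn: "sgn (ac j (x lam)) = sgn (ac j (rr \<beta> (x lam)))" "ac j (x lam) \<noteq> 0"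
    by (auto simp: sgn_if split: if_splits)
  have "ls_covers D lam (?y lam) (rr (s j \<beta>) (?y lam))"
  proof (rule reflect.IH [OF y])
    show "0 < co (s j \<beta>) (?y lam)" unfolding co by (rule reflect.prems(2))
    show "len (rr (s j \<beta>) \<circ> ?y) = len ?y + 1" using aux sgn(1) by linarith
  qed
  then show ?case
    using reflect sgn by (intro covers_s [where j = j]) (simp_all add: orbitI refl_s)
qed

section \<open>Transfer of edges, order and paths\<close>

text \<open>The pairing must be positive: zero would keep \<open>len\<close> fixed, and a negative
  value would make \<beta> lower it. The label \<beta> is retained, so integrality conditions carry
  over unchanged.\<close>

lemma sib_edge_lz_edge:
  assumes "sib_edge D J x \<beta> y" shows "lz_edge D lam (x lam) \<beta> (y lam)"
proof -
  have x: "x \<in> WJ_af D J" and \<beta>: "\<beta> \<in> Rp" and y: "y = rr \<beta> \<circ> x" "y \<in> WJ_af D J"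
    and "si_length D y = si_length D x + 1" using assms by (auto simp: sib_edge_def)
  then have len: "len (rr \<beta> \<circ> x) = len x + 1" by (simp add: len_si_length)
  have xW: "x \<in> Wa" by (rule WJ_Wa [OF x])
  have "0 < co \<beta> (x lam)"
  proof (rule ccontr)
    assume "\<not> 0 < co \<beta> (x lam)"
    then consider "co \<beta> (x lam) = 0" | "0 < co \<beta> ((rr \<beta> \<circ> x) lam)"
      by (fastforce simp: refl_refl(2) [OF \<beta>])
    then show False
    proof cases
      case 1
      then show False using len_refl(2) [OF \<beta> xW] len by simp
    next
      case 2
      have "rr \<beta> \<circ> (rr \<beta> \<circ> x) = x" by (simp add: fun_eq_iff refl_refl(1) [OF \<beta>])
      then have "len (rr \<beta> \<circ> x) < len x"
        using len_refl(1) [OF \<beta> Wa_comp [OF refl_in_Wa [OF \<beta>] xW] 2] by metis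
      then show False using len by linarith
    qed
  qed
  then show ?thesis using covers_refl [OF \<beta> xW _ len] \<beta> by (simp add: lz_edge_def y(1))
qed

lemma sib_edge_step: "sib_edge D J x \<beta> y \<Longrightarrow> step (x lam) (y lam)"
  using sib_edge_lz_edge [of x \<beta> y] by (auto simp: lz_edge_def step_def ls_covers_def)

lemma si_le_le: "si_le D J x y \<Longrightarrow> x lam \<preceq> y lam"
  unfolding si_le_def ls_le_step
  by (induction rule: rtranclp_induct) (auto intro: rtranclp.rtrancl_into_rtrancl sib_edge_step)

text \<open>Strictness comes from the first edge, whose image is a strict step; distinctness of
  \<open>x\<close> and \<open>y\<close> serves only to make the path nonempty.\<close>

lemma si_less_less: assumes "si_less D J x y" shows "x lam \<prec> y lam"
proof -
  obtain z \<beta> where "sib_edge D J x \<beta> z" "si_le D J z y"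
    using assms unfolding si_less_def si_le_def by (auto elim: converse_rtranclpE)
  then show ?thesis by (blast intro: less_le_trans step_less sib_edge_step si_le_le)
qed

lemma sib_path_lz_path: "sib_path D lam q x y \<Longrightarrow> lz_path D lam q (x lam) (y lam)"
  unfolding sib_path_def lz_path_def
proof (induction rule: rtranclp_induct)
  case (step y z)
  then have "\<exists>\<beta>. lz_edge D lam (y lam) \<beta> (z lam) \<and> q * of_int (co \<beta> (y lam)) \<in> \<int>"
    using sib_edge_lz_edge by blast
  with step.IH show ?case by (rule rtranclp.rtrancl_into_rtrancl)
qed simp

lemma SiLS_LS: assumes "(xs, as) \<in> SiLS D lam" shows "(map (\<lambda>x. x lam) xs, as) \<in> LS D lam"
proof -
  have "set xs \<subseteq> WJ_af D J" and "sorted_wrt (\<lambda>x y. si_less D J y x) xs"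
    and "rat_chain (length xs) as"
    and path: "\<And>u. u \<in> {1..<length xs} \<Longrightarrow> sib_path D lam (as ! u) (xs ! u) (xs ! (u - 1))"
    using assms by (auto simp: SiLS_def)
  moreover from this(2) have "sorted_wrt (\<lambda>x y. y lam \<prec> x lam) xs"
    by (rule sorted_wrt_mono_rel [rotated]) (rule si_less_less)
  moreover have "lz_path D lam (as ! u) (map (\<lambda>x. x lam) xs ! u) (map (\<lambda>x. x lam) xs ! (u - 1))"
    if "u \<in> {1..<length xs}" for u
    using sib_path_lz_path [OF path [OF that]] that by (simp add: less_imp_diff_less)
  ultimately show ?thesis
    by (auto simp: LS_def sorted_wrt_map intro: orbitI WJ_Wa)
qed

end

theorem proposition3p1p3:
  fixes D :: "('i::finite, 'p::ab_group_add) affine" and lam :: 'p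
  assumes "untwisted_affine D" and "lam \<in> P_plus D"
  shows "(\<lambda>(xs, as). (map (\<lambda>x. x lam) xs, as)) \<in> SiLS D lam \<rightarrow> LS D lam"
proof -
  interpret untwisted_dominant D lam
    using assms by unfold_locales
  show ?thesis by (auto intro: SiLS_LS)
qed

end
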